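(* If $f\colon\mathbb{R}^n\to\mathbb{R}^n$ is a convex monotone map with a fixed point, and the recession map $\hat{f}$ of $f$ has all its orbits bounded from above, then every orbit of $f$ converges to a Lyapunov stable periodic orbit of $f$ whose period divides $c(f)$.
   Context: Order on $\mathbb{R}^n$: $x\leq y$ iff $x_i\leq y_i$ for all $i$. A map $f$ is monotone if $x\leq y$ implies $f(x)\leq f(y)$, and convex if each coordinate function is convex. Recession map: $\hat f(x)=\lim_{\lambda\to\infty}\frac1\lambda f(\lambda x)\in(\mathbb{R}\cup\{\infty\})^n$ for $x\in\mathbb{R}^n$ (the limit exists since $f$ is convex). That $\hat f$ has all its orbits bounded from above means in particular that $\hat f$ is finite valued, and for each $x\in\mathbb{R}^n$ there is $u\in\mathbb{R}^n$ with $\hat f^k(x)\leq u$ for all $k\geq 0$. The orbit of $x$ converges to a periodic orbit if there is a periodic point $\xi$ of $f$, of period $p$, with $\lim_{k\to\infty}f^{kp}(x)=\xi$. A periodic orbit $\{\xi,f(\xi),\ldots,f^{p-1}(\xi)\}$ of period $p$ is Lyapunov stable if for all neighbourhoods $U_i$ of $f^i(\xi)$, $i=0,\ldots,p-1$, there exist neighbourhoods $V_i$ of $f^i(\xi)$ such that $f^{kp}(y)\in U_i$ for all $y\in V_i$, all $k\geq 0$ and all $i$. Critical graph: let $f'_v(y)=\lim_{\epsilon\downarrow 0}(f(v+\epsilon y)-f(v))/\epsilon$. A fixed point $v$ of $f$ is t-stable if every orbit of $f'_v\colon\mathbb{R}^n\to\mathbb{R}^n$ is bounded from above. (Under the hypotheses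 of the claim every fixed point of $f$ is t-stable, so that $c(f)$ below is defined.) $\partial f(v)$ is the set of real $n\times n$ matrices $M$ with $f(x)-f(v)\geq M(x-v)$ for all $x\in\mathbb{R}^n$. If $v$ is a t-stable fixed point, all matrices in $\partial f(v)$ are nonnegative and stable (a matrix $P$ is stable if all its orbits $\{P^kx\colon k\geq 0\}$ are bounded). For a nonnegative $n\times n$ matrix $P$, $\mathcal{G}(P)$ is the directed graph on $\{1,\ldots,n\}$ with an arrow from $i$ to $j$ iff $p_{ij}>0$; the classes of $P$ are the equivalence classes of the relation "$i$ has access to $j$ and $j$ has access to $i$" (access = existence of a directed path; each node has access to itself). If $P$ is stable, a class $K$ is critical if $P_{KK}$ has spectral radius $1$; $N^c(P)$ is the union of the critical classes and $\mathcal{G}^c(P)$ is the restriction of $\mathcal{G}(P)$ to $N^c(P)$. One puts $\mathcal{G}^c(f)=\bigcup_{P\in\partial f(v)}\mathcal{G}^c(P)$ for a t-stable fixed point $v$; this does not depend on the choice of $v$. Cyclicity: the cyclicity of a strongly connected directed graph is the greatest common divisor of the lengths of its circuits; the cyclicity $c(\mathcal{G})$ of a general directed graph is the least common multiple of the cyclicities of its strongly connected components (equal to $1$ for the empty graph). Finally $c(f)=c(\mathcal{G}^c(f))$. *)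

theory Defs
  imports "HOL-Analysis.Analysis" "Jordan_Normal_Form.Spectral_Radius"
begin

no_notation vec_index (infixl "$" 100)

text \<open>The order on \<^typ>\<open>real ^ 'n\<close> is the componentwise one, so a monotone map is
  one satisfying \<^const>\<open>mono\<close>.\<close>

definition convex_map :: "(real ^ 'n \<Rightarrow> real ^ 'm) \<Rightarrow> bool" where
  "convex_map f \<longleftrightarrow> (\<forall>i. convex_on UNIV (\<lambda>x. f x $ i))"

definition orbits_bounded_above :: "(real ^ 'n \<Rightarrow> real ^ 'n) \<Rightarrow> bool" where
  "orbits_bounded_above g \<longleftrightarrow> (\<forall>x. \<exists>u. \<forall>k. (g ^^ k) x \<le> u)"


subsection \<open>Recession map\<close>

definition recession_map :: "(real ^ 'n \<Rightarrow> real ^ 'n) \<Rightarrow> real ^ 'n \<Rightarrow> ereal ^ 'n" where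
  "recession_map f x = (\<chi> i. Lim at_top (\<lambda>r::real. ereal ((f (r *\<^sub>R x) $ i) / r)))"

text \<open>Finite-valuedness comes first: only then do iterates of the recession map make sense.\<close>

definition recession_orbits_bounded_above :: "(real ^ 'n \<Rightarrow> real ^ 'n) \<Rightarrow> bool" where
  "recession_orbits_bounded_above f \<longleftrightarrow>
     (\<forall>x i. \<bar>recession_map f x $ i\<bar> \<noteq> \<infinity>) \<and>
     orbits_bounded_above (\<lambda>x. \<chi> i. real_of_ereal (recession_map f x $ i))"


subsection \<open>Periodic orbits\<close>

text \<open>The period is the minimal one.\<close>

definition periodic_point :: "('a \<Rightarrow> 'a) \<Rightarrow> 'a \<Rightarrow> nat \<Rightarrow> bool" where
  "periodic_point f \<xi> p \<longleftrightarrow>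
     p > 0 \<and> (f ^^ p) \<xi> = \<xi> \<and> (\<forall>q. 0 < q \<and> q < p \<longrightarrow> (f ^^ q) \<xi> \<noteq> \<xi>)"

text \<open>A neighbourhood of a point is a set with the point in its interior.\<close>

definition lyapunov_stable_orbit :: "(real ^ 'n \<Rightarrow> real ^ 'n) \<Rightarrow> real ^ 'n \<Rightarrow> nat \<Rightarrow> bool" where
  "lyapunov_stable_orbit f \<xi> p \<longleftrightarrow>
     (\<forall>U. (\<forall>i<p. (f ^^ i) \<xi> \<in> interior (U i)) \<longrightarrow>
       (\<exists>V. (\<forall>i<p. (f ^^ i) \<xi> \<in> interior (V i)) \<and>
            (\<forall>i<p. \<forall>y \<in> V i. \<forall>k. (f ^^ (k * p)) y \<in> U i)))"


subsection \<open>Classes and cyclicity of digraphs\<close>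

text \<open>A digraph is represented by its arc relation. The classes form a partition of the whole
  type; nodes that lie on no circuit are irrelevant for the cyclicity, see below.\<close>

definition access_classes :: "('a \<times> 'a) set \<Rightarrow> 'a set set" where
  "access_classes E = UNIV // {(i, j). (i, j) \<in> E\<^sup>* \<and> (j, i) \<in> E\<^sup>*}"

definition circuit_lengths :: "('a \<times> 'a) set \<Rightarrow> nat set" where
  "circuit_lengths E = {k. k > 0 \<and> (\<exists>i. (i, i) \<in> E ^^ k)}"

text \<open>Components without circuits are left out; otherwise they would contribute
  \<^term>\<open>Gcd {} = (0::nat)\<close> and every number would divide the cyclicity. This is the usual
  convention that a single node without loop has cyclicity 1. The empty graph has
  cyclicity \<^term>\<open>Lcm {} = (1::nat)\<close>.\<close>

definition cyclicity :: "('a \<times> 'a) set \<Rightarrow> nat" where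
  "cyclicity E = Lcm {Gcd (circuit_lengths (E \<inter> C \<times> C)) | C.
     C \<in> access_classes E \<and> circuit_lengths (E \<inter> C \<times> C) \<noteq> {}}"


subsection \<open>Critical graph of a nonnegative matrix\<close>

definition digraph_of_matrix :: "real ^ 'n ^ 'n \<Rightarrow> ('n \<times> 'n) set" where
  "digraph_of_matrix P = {(i, j). P $ i $ j > 0}"

text \<open>The submatrix on rows and columns \<open>K\<close>, in the representation for which
  \<^const>\<open>spectral_radius\<close> is defined. The enumeration \<^term>\<open>from_nat_into K\<close> is a bijection from
  \<^term>\<open>{..<card K}\<close> to \<open>K\<close>; the spectral radius does not depend on it.\<close>

definition principal_submatrix :: "real ^ 'n ^ 'n \<Rightarrow> 'n set \<Rightarrow> complex Matrix.mat" where
  "principal_submatrix P K = Matrix.mat (card K) (card K)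
     (\<lambda>(a, b). complex_of_real (P $ from_nat_into K a $ from_nat_into K b))"

definition critical_classes :: "real ^ 'n ^ 'n \<Rightarrow> 'n set set" where
  "critical_classes P =
     {K \<in> access_classes (digraph_of_matrix P). spectral_radius (principal_submatrix P K) = 1}"

definition critical_nodes :: "real ^ 'n ^ 'n \<Rightarrow> 'n set" where
  "critical_nodes P = \<Union>(critical_classes P)"

definition critical_digraph :: "real ^ 'n ^ 'n \<Rightarrow> ('n \<times> 'n) set" where
  "critical_digraph P = digraph_of_matrix P \<inter> critical_nodes P \<times> critical_nodes P"


subsection \<open>Critical graph of a convex monotone map\<close>

definition directional_derivative ::
    "(real ^ 'n \<Rightarrow> real ^ 'n) \<Rightarrow> real ^ 'n \<Rightarrow> real ^ 'n \<Rightarrow> real ^ 'n" where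
  "directional_derivative f v y =
     Lim (at_right 0) (\<lambda>\<epsilon>::real. (f (v + \<epsilon> *\<^sub>R y) - f v) /\<^sub>R \<epsilon>)"

definition t_stable_fixed_point :: "(real ^ 'n \<Rightarrow> real ^ 'n) \<Rightarrow> real ^ 'n \<Rightarrow> bool" where
  "t_stable_fixed_point f v \<longleftrightarrow> f v = v \<and> orbits_bounded_above (directional_derivative f v)"

definition subdifferential ::
    "(real ^ 'n \<Rightarrow> real ^ 'n) \<Rightarrow> real ^ 'n \<Rightarrow> (real ^ 'n ^ 'n) set" where
  "subdifferential f v = {M. \<forall>x. M *v (x - v) \<le> f x - f v}"

text \<open>The choice of the t-stable fixed point is immaterial: for convex monotone \<open>f\<close> all of
  them yield the same graph.\<close>

definition critical_digraph_map :: "(real ^ 'n \<Rightarrow> real ^ 'n) \<Rightarrow> ('n \<times> 'n) set" where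
  "critical_digraph_map f =
     (\<Union>P \<in> subdifferential f (SOME v. t_stable_fixed_point f v). critical_digraph P)"

definition cyclicity_map :: "(real ^ 'n \<Rightarrow> real ^ 'n) \<Rightarrow> nat" where
  "cyclicity_map f = cyclicity (critical_digraph_map f)"

end

theory Submission
  imports Defs "HOL-Real_Asymp.Real_Asymp"
begin

text \<open>Translate a t-stable fixed point to \<open>0\<close>. Differences of orbits of \<open>f\<close> are dominated by orbits of
  the recession map, so the iterates of \<open>f\<close> are uniformly Lipschitz; this gives stability, and every
  limit point of an orbit is recurrent. A continuous function that is monotone along all recurrent
  orbits is constant along them. Applied to left eigenvectors of a subgradient at \<open>0\<close> and a critical
  class, this shows that along an arc \<open>(i, j)\<close> of the critical graph the coordinate \<open>i\<close> of the next
  point is a fixed positive multiple of the coordinate \<open>j\<close>, so the critical coordinates of a recurrent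
  point are periodic with period \<open>c(f)\<close>.

  It remains to see that two recurrent orbits that agree on the critical nodes coincide. If not, their
  difference keeps a positive amount of mass off the critical nodes under products of subgradients
  along the orbit. Time averages of this mass converge to an invariant measure, off the critical nodes,
  of some subgradient at \<open>0\<close>; its support meets a critical class, a contradiction.\<close>

no_notation scalar_prod (infix "\<bullet>" 70)

section \<open>Stable nonnegative matrices\<close>

text \<open>The obstacle is that subgradients along an orbit change with time, and products of
  different matrices have no spectral theory; only a single subgradient at the fixed point has
  critical classes. Averaging removes the time dependence. The inequality of a subgradient at an
  orbit point differs from one at the fixed point by a nonnegative slack, and the slack weighted by
  the transported mass telescopes along the bounded orbit, up to leaked mass. So its total is
  bounded independently of the horizon n and disappears after division by n. The averages are kept
  as a pair of a measure M and a flow A, not as M with normalised rows, since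
  \<open>(A *v x) $ j \<le> M $ j * F x $ j\<close> is linear in the pair and survives limits even
  where M vanishes. Recurrence enters at the end: at return times the difference of the two orbits
  is close to the original one, which keeps the average mass away from 0. Orbits have no sign, so
  the conserved quantities on critical classes are built from absolute values.\<close>

lemma vec_le_iff: "(x :: real ^ 'n) \<le> y \<longleftrightarrow> (\<forall>i. x $ i \<le> y $ i)"
  by (simp add: Finite_Cartesian_Product.less_eq_vec_def)

lemma cart_eq_iff: "(x :: real ^ 'n) = y \<longleftrightarrow> (\<forall>i. x $ i = y $ i)"
  by (simp add: Finite_Cartesian_Product.vec_eq_iff)

text \<open>Turns a subinvariant vector with bounded orbit into an invariant one above it: the orbit
  increases in each coordinate, and continuity makes its limit fixed. Perron vectors are produced in
  this way.\<close>

lemma mono_iterates_fixed_point: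
  fixes f :: "real ^ 'n \<Rightarrow> real ^ 'n"
  assumes mono: "mono f" and cont: "continuous_on UNIV f"
    and start: "x \<le> f x" and bounded: "\<And>k. (f ^^ k) x \<le> u"
  obtains y where "x \<le> y" "f y = y"
proof -
  define a where "a k = (f ^^ k) x" for k
  have "incseq a"
  proof (rule incseq_SucI)
    show "a k \<le> a (Suc k)" for k
      using start by (induction k) (auto simp: a_def intro: monoD[OF mono])
  qed
  have "\<exists>l. (\<lambda>k. a k $ i) \<longlonglongrightarrow> l \<and> (\<forall>k. a k $ i \<le> l)" for i
  proof -
    have "incseq (\<lambda>k. a k $ i)"
      using \<open>incseq a\<close> by (simp add: incseq_def vec_le_iff)
    moreover have "a k $ i \<le> u $ i" for k
      using bounded[of k] by (simp add: vec_le_iff a_def)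
    ultimately show ?thesis
      by (metis incseq_convergent)
  qed
  then obtain l where l: "\<And>i. (\<lambda>k. a k $ i) \<longlonglongrightarrow> l i" "\<And>i k. a k $ i \<le> l i"
    by metis
  define y where "y = (\<chi> i. l i)"
  have lim: "a \<longlonglongrightarrow> y"
    by (rule vec_tendstoI) (simp add: y_def l)
  have "(\<lambda>k. f (a k)) \<longlonglongrightarrow> f y"
    using cont lim by (metis continuous_on_eq_continuous_at isCont_tendsto_compose open_UNIV UNIV_I)
  moreover have "(\<lambda>k. f (a k)) \<longlonglongrightarrow> y"
    using LIMSEQ_Suc[OF lim] by (simp add: a_def)
  ultimately have "f y = y"
    by (rule LIMSEQ_unique)
  moreover have "x \<le> y"
    using l(2)[where k = 0] by (simp add: vec_le_iff y_def a_def)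
  ultimately show thesis
    using that by blast
qed

section \<open>Access classes of a digraph\<close>

lemma access_class_iff:
  assumes "K \<in> access_classes E" "i \<in> K"
  shows "j \<in> K \<longleftrightarrow> (i, j) \<in> E\<^sup>* \<and> (j, i) \<in> E\<^sup>*"
  using assms unfolding access_classes_def quotient_def
  by (auto intro: rtrancl_trans)

lemma access_class_exists: "\<exists>K \<in> access_classes E. i \<in> K"
  unfolding access_classes_def quotient_def by auto

lemma access_class_nonempty: "K \<in> access_classes E \<Longrightarrow> K \<noteq> {}"
  unfolding access_classes_def quotient_def by auto

text \<open>A path between two members of a class cannot leave it: each node on it is accessible
  from one end and has access to the other.\<close>

lemma access_class_path:
  assumes K: "K \<in> access_classes E" and i: "i \<in> K" and j: "j \<in> K"
  shows "(i, j) \<in> (E \<inter> K \<times> K)\<^sup>*"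
proof -
  have "(i, z) \<in> E\<^sup>* \<Longrightarrow> (z, j) \<in> E\<^sup>* \<Longrightarrow> (i, z) \<in> (E \<inter> K \<times> K)\<^sup>*" for z
  proof (induction rule: rtrancl_induct)
    case base
    show ?case by simp
  next
    case (step y z)
    have ji: "(j, i) \<in> E\<^sup>*" and "(i, z) \<in> E\<^sup>*" "(y, j) \<in> E\<^sup>*"
      using access_class_iff[OF K i] j step by auto
    then have "y \<in> K" "z \<in> K"
      using access_class_iff[OF K i] step by (meson rtrancl_trans)+
    with step \<open>(y, j) \<in> E\<^sup>*\<close> show ?case
      by (meson IntI SigmaI rtrancl.simps)
  qed
  then show ?thesis
    using access_class_iff[OF K i] j by auto
qed

lemma matrix_vector_mono:
  fixes P :: "real ^ 'n ^ 'm"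
  assumes "\<And>i j. 0 \<le> P $ i $ j" "x \<le> y"
  shows "P *v x \<le> P *v y"
  using assms by (auto simp: vec_le_iff matrix_vector_mult_def intro!: sum_mono mult_left_mono)

lemma inner_mono_vec:
  fixes m x y :: "real ^ 'n"
  assumes "\<And>i. 0 \<le> m $ i" "x \<le> y"
  shows "m \<bullet> x \<le> m \<bullet> y"
  using assms by (auto simp: vec_le_iff inner_vec_def intro!: sum_mono mult_left_mono)

text \<open>Trades the enumerated matrix on which \<open>spectral_radius\<close> is defined for
  functions on the nodes of K, so that the enumeration of K is dealt with once.\<close>

lemma eigenvalue_principal_submatrix:
  fixes P :: "real ^ 'n ^ 'n"
  shows "eigenvalue (principal_submatrix P K) c \<longleftrightarrow>
    (\<exists>z. (\<exists>i\<in>K. z i \<noteq> 0) \<and> (\<forall>i\<in>K. (\<Sum>j\<in>K. of_real (P $ i $ j) * z j) = c * z i))"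
proof -
  define n where "n = card K"
  define e where "e = from_nat_into K"
  define A where "A = principal_submatrix P K"
  have bij: "bij_betw e {..<n} K"
    unfolding e_def n_def by (rule bij_betw_from_nat_into_finite) simp
  have mem: "e a \<in> K" if "a < n" for a
    using bij that by (auto simp: bij_betw_def)
  have A: "A \<in> carrier_mat n n" "dim_row A = n"
    by (auto simp: A_def n_def principal_submatrix_def)
  have mult: "vec_index (A *\<^sub>v v) a = (\<Sum>b<n. of_real (P $ e a $ e b) * vec_index v b)"
    if "a < n" "v \<in> carrier_vec n" for a v
    using that by (auto simp: A_def principal_submatrix_def scalar_prod_def n_def e_def
        lessThan_atLeast0 intro!: sum.cong)
  show ?thesis
    unfolding A_def[symmetric] eigenvalue_def
  proof
    assume "\<exists>v. eigenvector A v c"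
    then obtain v where v: "v \<in> carrier_vec n" "v \<noteq> 0\<^sub>v n" "A *\<^sub>v v = c \<cdot>\<^sub>v v"
      using A unfolding eigenvector_def by auto
    define z where "z i = vec_index v (the_inv_into {..<n} e i)" for i
    have z: "z (e a) = vec_index v a" if "a < n" for a
      using bij that by (simp add: z_def bij_betw_def the_inv_into_f_f)
    obtain a where "a < n" "vec_index v a \<noteq> 0"
      using v(1,2) by (metis carrier_vecD eq_vecI index_zero_vec)
    then have "\<exists>i\<in>K. z i \<noteq> 0"
      using z mem by metis
    moreover have "(\<Sum>j\<in>K. of_real (P $ i $ j) * z j) = c * z i" if "i \<in> K" for i
    proof -
      obtain a where a: "a < n" "i = e a"
        using \<open>i \<in> K\<close> bij by (auto simp: bij_betw_def)
      have "(\<Sum>j\<in>K. of_real (P $ i $ j) * z j) = (\<Sum>b<n. of_real (P $ i $ e b) * z (e b))"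
        by (rule sum.reindex_bij_betw[OF bij, symmetric])
      also have "\<dots> = vec_index (A *\<^sub>v v) a"
        using a z v(1) by (simp add: mult)
      also have "\<dots> = c * z i"
        using a v z by simp
      finally show ?thesis .
    qed
    ultimately show "\<exists>z. (\<exists>i\<in>K. z i \<noteq> 0) \<and>
        (\<forall>i\<in>K. (\<Sum>j\<in>K. of_real (P $ i $ j) * z j) = c * z i)"
      by blast
  next
    assume "\<exists>z. (\<exists>i\<in>K. z i \<noteq> 0) \<and>
        (\<forall>i\<in>K. (\<Sum>j\<in>K. of_real (P $ i $ j) * z j) = c * z i)"
    then obtain z i0 where z: "i0 \<in> K" "z i0 \<noteq> 0"
        "\<And>i. i \<in> K \<Longrightarrow> (\<Sum>j\<in>K. of_real (P $ i $ j) * z j) = c * z i"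
      by blast
    define v where "v = Matrix.vec n (\<lambda>a. z (e a))"
    have v: "v \<in> carrier_vec n"
      by (simp add: v_def)
    obtain a0 where "a0 < n" "i0 = e a0"
      using z bij by (auto simp: bij_betw_def)
    then have "v \<noteq> 0\<^sub>v n"
      using z(2) by (metis index_vec index_zero_vec(1) v_def)
    moreover have "A *\<^sub>v v = c \<cdot>\<^sub>v v"
    proof (rule eq_vecI)
      fix a assume "a < dim_vec (c \<cdot>\<^sub>v v)"
      then have a: "a < n" by (simp add: v_def)
      have "vec_index (A *\<^sub>v v) a = (\<Sum>b<n. of_real (P $ e a $ e b) * z (e b))"
        using a v by (simp add: mult) (simp add: v_def)
      also have "\<dots> = (\<Sum>j\<in>K. of_real (P $ e a $ j) * z j)"
        by (rule sum.reindex_bij_betw[OF bij])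
      also have "\<dots> = vec_index (c \<cdot>\<^sub>v v) a"
        using a mem z(3) by (simp add: v_def)
      finally show "vec_index (A *\<^sub>v v) a = vec_index (c \<cdot>\<^sub>v v) a" .
    qed (use A in \<open>simp add: v_def\<close>)
    ultimately show "\<exists>v. eigenvector A v c"
      using v A unfolding eigenvector_def by auto
  qed
qed

text \<open>The parameter \<open>U\<close> bounds all orbits of \<open>P\<close>, as every vector lies below a multiple of
  the all-ones vector.\<close>

locale stable_matrix =
  fixes P :: "real ^ 'n ^ 'n" and U :: "real ^ 'n"
  assumes nonneg: "0 \<le> P $ i $ j"
    and powers_bounded: "((\<lambda>x. P *v x) ^^ k) 1 \<le> U"
begin

lemma mono_mult: "mono (\<lambda>x. P *v x)"
  by (rule monoI) (rule matrix_vector_mono[OF nonneg])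

lemma powers_scale: "((\<lambda>x. P *v x) ^^ k) (a *\<^sub>R x) = a *\<^sub>R ((\<lambda>x. P *v x) ^^ k) x"
  by (induction k) (simp_all add: scaleR_matrix_vector_assoc matrix_vector_mult_scaleR)

lemma orbit_bounded:
  obtains b where "\<And>k. ((\<lambda>x. P *v x) ^^ k) x \<le> b"
proof
  define a where "a = (\<Sum>i\<in>UNIV. \<bar>x $ i\<bar>)"
  fix k
  have "x $ i \<le> a" for i
    unfolding a_def using member_le_sum[of i UNIV "\<lambda>i. \<bar>x $ i\<bar>"] by auto
  then have "x \<le> a *\<^sub>R 1"
    by (simp add: vec_le_iff)
  then have "((\<lambda>x. P *v x) ^^ k) x \<le> ((\<lambda>x. P *v x) ^^ k) (a *\<^sub>R 1)"
    using funpow_mono[OF mono_mult] by blast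
  also have "\<dots> \<le> a *\<^sub>R U"
    unfolding powers_scale using powers_bounded[of k]
    by (auto simp: a_def vec_le_iff intro!: mult_left_mono sum_nonneg)
  finally show "((\<lambda>x. P *v x) ^^ k) x \<le> a *\<^sub>R U" .
qed

text \<open>An expansion by a > 1 would iterate to growth like \<open>a ^ k\<close>, while orbits
  are bounded above.\<close>

lemma growth_le_1:
  assumes "0 \<le> x" "x \<noteq> 0" "a *\<^sub>R x \<le> P *v x"
  shows "a \<le> 1"
proof (rule ccontr)
  assume "\<not> a \<le> 1"
  then have a: "1 < a" by simp
  have grow: "a ^ k *\<^sub>R x \<le> ((\<lambda>x. P *v x) ^^ k) x" for k
  proof (induction k)
    case (Suc k)
    have "a ^ Suc k *\<^sub>R x = a ^ k *\<^sub>R (a *\<^sub>R x)"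
      by simp
    also have "\<dots> \<le> a ^ k *\<^sub>R (P *v x)"
      using assms(3) a by (auto simp: vec_le_iff intro!: mult_left_mono)
    also have "\<dots> = P *v (a ^ k *\<^sub>R x)"
      by (simp add: matrix_vector_mult_scaleR)
    also have "\<dots> \<le> P *v ((\<lambda>x. P *v x) ^^ k) x"
      by (rule matrix_vector_mono[OF nonneg Suc])
    finally show ?case by simp
  qed simp
  obtain b where b: "\<And>k. ((\<lambda>x. P *v x) ^^ k) x \<le> b"
    using orbit_bounded by blast
  obtain i where "x $ i > 0"
    using assms(1,2) by (auto simp: vec_le_iff cart_eq_iff order_le_less)
  moreover obtain k where "b $ i / x $ i < a ^ k"
    using real_arch_pow[OF a] by blast
  moreover have "a ^ k * x $ i \<le> b $ i"
    using order_trans[OF grow b, of k] by (simp add: vec_le_iff)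
  ultimately show False
    by (simp add: divide_simps)
qed

text \<open>The principal block padded by zeros to full size, so that it acts on the same space as P
  and its orbits can be compared with those of P.\<close>

definition truncation :: "'n set \<Rightarrow> real ^ 'n ^ 'n" where
  "truncation K = (\<chi> i j. if i \<in> K \<and> j \<in> K then P $ i $ j else 0)"

lemma truncation_mult:
  "(truncation K *v x) $ i = (if i \<in> K then \<Sum>j\<in>K. P $ i $ j * x $ j else 0)"
proof -
  have "(\<Sum>j\<in>UNIV. (if j \<in> K then P $ i $ j else 0) * x $ j) = (\<Sum>j\<in>K. P $ i $ j * x $ j)"
    by (rule sum.mono_neutral_cong_right) auto
  then show ?thesis
    by (auto simp: truncation_def matrix_vector_mult_def)
qed

lemma truncation_nonneg: "0 \<le> truncation K $ i $ j"
  by (simp add: truncation_def nonneg)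

lemma truncation_le: "0 \<le> x \<Longrightarrow> truncation K *v x \<le> P *v x"
  unfolding vec_le_iff
  by (auto simp: truncation_def matrix_vector_mult_def nonneg vec_le_iff intro!: sum_mono)

text \<open>The moduli of the entries of a complex eigenvector form a nonnegative vector that, by
  the triangle inequality, is multiplied by at least \<open>cmod c\<close>. When
  \<open>cmod c = 1\<close> this is the starting vector for the Perron vector of the block.\<close>

lemma eigenvalue_norm_le_1:
  assumes "eigenvalue (principal_submatrix P K) c"
  shows "cmod c \<le> 1"
    and "cmod c = 1 \<Longrightarrow> \<exists>x\<ge>0. x \<noteq> 0 \<and> (\<forall>i. i \<notin> K \<longrightarrow> x $ i = 0) \<and> x \<le> truncation K *v x"
proof -
  obtain z i0 where z: "i0 \<in> K" "z i0 \<noteq> 0"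
      "\<And>i. i \<in> K \<Longrightarrow> (\<Sum>j\<in>K. of_real (P $ i $ j) * z j) = c * z i"
    using assms unfolding eigenvalue_principal_submatrix by blast
  define x where "x = (\<chi> i. if i \<in> K then cmod (z i) else 0)"
  have x0: "0 \<le> x" "x \<noteq> 0"
    using z(1,2) by (auto simp: vec_le_iff x_def cart_eq_iff)
  have "cmod c * cmod (z i) \<le> (\<Sum>j\<in>K. P $ i $ j * cmod (z j))" if "i \<in> K" for i
  proof -
    have "cmod c * cmod (z i) = cmod (\<Sum>j\<in>K. of_real (P $ i $ j) * z j)"
      using z(3)[OF that] by (simp add: norm_mult)
    also have "\<dots> \<le> (\<Sum>j\<in>K. cmod (of_real (P $ i $ j) * z j))"
      by (rule norm_sum)
    finally show ?thesis
      by (simp add: norm_mult nonneg)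
  qed
  then have le: "cmod c *\<^sub>R x \<le> truncation K *v x"
    by (auto simp: vec_le_iff truncation_mult x_def)
  show "cmod c \<le> 1"
    using growth_le_1[OF x0 order_trans[OF le truncation_le[OF x0(1)]]] .
  show "\<exists>x\<ge>0. x \<noteq> 0 \<and> (\<forall>i. i \<notin> K \<longrightarrow> x $ i = 0) \<and> x \<le> truncation K *v x" if "cmod c = 1"
    using le that x0 by (intro exI[of _ x]) (auto simp: x_def)
qed

lemma critical_classI:
  assumes K: "K \<in> access_classes (digraph_of_matrix P)"
    and eigen: "eigenvalue (principal_submatrix P K) 1"
  shows "K \<in> critical_classes P"
proof -
  define A where "A = principal_submatrix P K"
  have A: "A \<in> carrier_mat (card K) (card K)"
    by (simp add: A_def principal_submatrix_def)
  have pos: "card K > 0"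
    using access_class_nonempty[OF K] by (simp add: card_gt_0_iff)
  have "norm ` spectrum A \<subseteq> {..1}"
    using eigenvalue_norm_le_1(1) by (auto simp: spectrum_def A_def)
  then have "spectral_radius A \<le> 1"
    using spectral_radius_mem_max(1)[OF A pos] by auto
  moreover have "1 \<le> spectral_radius A"
    using eigen by (intro spectral_radius_mem_max(2)[OF A pos])
      (force simp: spectrum_def A_def)
  ultimately show ?thesis
    using K by (simp add: critical_classes_def A_def)
qed

text \<open>Positivity travels backwards along the arcs of the class, because
  \<open>P $ y $ z * x $ z\<close> is a lower bound of \<open>x $ y\<close>.\<close>

lemma critical_class_positive:
  assumes K: "K \<in> access_classes (digraph_of_matrix P)"
    and x: "0 \<le> x" "i \<in> K" "0 < x $ i" "\<And>i j. i \<in> K \<Longrightarrow> j \<in> K \<Longrightarrow> P $ i $ j * x $ j \<le> x $ i"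
    and j: "j \<in> K"
  shows "0 < x $ j"
  using access_class_path[OF K j x(2)]
proof (induction rule: converse_rtrancl_induct)
  case (step y z)
  then have "0 < P $ y $ z * x $ z"
    by (auto simp: digraph_of_matrix_def)
  with x(4)[of y z] step show ?case
    by auto
qed (rule x)

text \<open>Perron--Frobenius for a critical class. A class may have access to noncritical nodes, so \<open>l\<close> is
  only subinvariant for \<open>P\<close>; its images under powers of \<open>P\<close> increase to \<open>m\<close>.\<close>

lemma critical_class_eigenvectors:
  assumes "K \<in> critical_classes P"
  obtains h l m where
    "0 \<le> h" "\<And>i. i \<in> K \<Longrightarrow> 0 < h $ i" "\<And>i. i \<notin> K \<Longrightarrow> h $ i = 0" "truncation K *v h = h"
    "0 \<le> l" "\<And>i. i \<in> K \<Longrightarrow> 0 < l $ i" "\<And>i. i \<notin> K \<Longrightarrow> l $ i = 0" "l v* truncation K = l"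
    "l \<le> m" "m v* P = m"
proof -
  define A where "A = principal_submatrix P K"
  define B where "B = truncation K"
  have K: "K \<in> access_classes (digraph_of_matrix P)" "spectral_radius A = 1"
    using assms by (auto simp: critical_classes_def A_def)
  have A: "A \<in> carrier_mat (card K) (card K)"
    by (simp add: A_def principal_submatrix_def)
  have pos: "card K > 0"
    using access_class_nonempty[OF K(1)] by (simp add: card_gt_0_iff)
  obtain c where c: "eigenvalue A c" "cmod c = 1"
    using spectral_radius_mem_max(1)[OF A pos] K(2) by (auto simp: spectrum_def)
  obtain x where x: "0 \<le> x" "x \<noteq> 0" "\<And>i. i \<notin> K \<Longrightarrow> x $ i = 0" "x \<le> B *v x"
    using eigenvalue_norm_le_1(2)[OF c(1)[unfolded A_def] c(2)] by (auto simp: B_def)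
  have monoB: "mono (\<lambda>x. B *v x)"
    by (rule monoI) (simp add: B_def matrix_vector_mono truncation_nonneg)
  obtain b where b: "\<And>k. ((\<lambda>x. P *v x) ^^ k) x \<le> b"
    using orbit_bounded by blast
  \<comment> \<open>The iterates of the block stay below those of P, which are bounded; so they
    increase to a fixed vector.\<close>
  have "0 \<le> ((\<lambda>x. B *v x) ^^ k) x \<and> ((\<lambda>x. B *v x) ^^ k) x \<le> ((\<lambda>x. P *v x) ^^ k) x" for k
  proof (induction k)
    case (Suc k)
    let ?y = "((\<lambda>x. B *v x) ^^ k) x"
    have "0 \<le> B *v ?y"
      using monoD[OF monoB, of 0 ?y] Suc by simp
    moreover have "B *v ?y \<le> P *v ?y"
      using Suc by (simp add: B_def truncation_le)
    moreover have "\<dots> \<le> P *v ((\<lambda>x. P *v x) ^^ k) x"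
      using Suc by (simp add: matrix_vector_mono nonneg)
    ultimately show ?case
      by auto
  qed (simp add: x)
  then have "((\<lambda>x. B *v x) ^^ k) x \<le> b" for k
    using b order_trans by blast
  then obtain h where h: "x \<le> h" "B *v h = h"
    by (rule mono_iterates_fixed_point[OF monoB matrix_vector_mult_linear_continuous_on x(4)])
  have h0: "0 \<le> h"
    using x(1) h(1) by (rule order_trans)
  have hout: "h $ i = 0" if "i \<notin> K" for i
    using h(2) that by (metis B_def truncation_mult)
  obtain i0 where "i0 \<in> K" "0 < x $ i0"
    using x(1-3) by (auto simp: vec_le_iff cart_eq_iff order_le_less)
  then have i0: "i0 \<in> K" "0 < h $ i0"
    using h(1) by (auto simp: vec_le_iff intro: less_le_trans)
  have hpos: "0 < h $ i" if "i \<in> K" for i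
  proof (rule critical_class_positive[OF K(1) h0 i0 _ that])
    fix i j assume "i \<in> K" "j \<in> K"
    then have "P $ i $ j * h $ j \<le> (\<Sum>j\<in>K. P $ i $ j * h $ j)"
      using h0 by (intro member_le_sum) (auto simp: nonneg vec_le_iff)
    with h(2) \<open>i \<in> K\<close> show "P $ i $ j * h $ j \<le> h $ i"
      by (metis B_def truncation_mult)
  qed
  \<comment> \<open>B - 1 is singular because of h, hence so is its transpose.\<close>
  have "\<exists>l. l \<noteq> 0 \<and> l v* B = l"
  proof (rule ccontr)
    assume "\<nexists>l. l \<noteq> 0 \<and> l v* B = l"
    then have "invertible (Finite_Cartesian_Product.transpose (B - Finite_Cartesian_Product.mat 1))"
      by (subst invertible_left_inverse, subst matrix_left_invertible_ker)
        (auto simp: vector_matrix_mult_diff_rdistrib)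
    then have "invertible (B - Finite_Cartesian_Product.mat 1)"
      using transpose_invertible by fastforce
    then have "h = 0"
      using h(2) unfolding invertible_left_inverse matrix_left_invertible_ker
      by (simp add: matrix_vector_mult_diff_rdistrib)
    with i0 show False by simp
  qed
  then obtain l' where l': "l' \<noteq> 0" "l' v* B = l'"
    by blast
  \<comment> \<open>\<open>l'\<close> may have entries of both signs. Its moduli form a subinvariant
    vector, and pairing the excess with h, which is positive on K, shows that it is
    invariant.\<close>
  define l where "l = (\<chi> i. \<bar>l' $ i\<bar>)"
  have l0: "0 \<le> l"
    by (simp add: l_def vec_le_iff)
  have lle: "l \<le> l v* B"
  proof -
    have "\<bar>l' $ j\<bar> \<le> (\<Sum>i\<in>UNIV. \<bar>l' $ i\<bar> * B $ i $ j)" for j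
    proof -
      have "\<bar>l' $ j\<bar> = \<bar>\<Sum>i\<in>UNIV. l' $ i * B $ i $ j\<bar>"
        using arg_cong[OF l'(2), of "\<lambda>v. \<bar>v $ j\<bar>"] by (simp add: vector_matrix_mult_def)
      also have "\<dots> \<le> (\<Sum>i\<in>UNIV. \<bar>l' $ i * B $ i $ j\<bar>)"
        by (rule sum_abs)
      finally show ?thesis
        by (simp add: abs_mult truncation_nonneg B_def)
    qed
    then show ?thesis
      by (simp add: vec_le_iff l_def vector_matrix_mult_def)
  qed
  have lB_out: "(y v* B) $ j = 0" if "j \<notin> K" for y j
    using that by (simp add: vector_matrix_mult_def B_def truncation_def)
  have lout: "l $ j = 0" if "j \<notin> K" for j
    using l'(2) lB_out[OF that] by (metis abs_zero l_def vec_lambda_beta)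
  have leq: "l v* B = l"
  proof -
    have "(l v* B - l) \<bullet> h = 0"
      by (simp add: inner_diff_left dot_lmul_matrix h(2))
    then have "(\<Sum>i\<in>UNIV. (l v* B - l) $ i * h $ i) = 0"
      by (simp add: inner_vec_def)
    moreover have "0 \<le> (l v* B - l) $ i * h $ i" for i
      using lle h0 by (simp add: vec_le_iff)
    ultimately have "(l v* B - l) $ i * h $ i = 0" for i
      by (simp add: sum_nonneg_eq_0_iff)
    then have "(l v* B - l) $ i = 0 \<or> h $ i = 0" for i
      by simp
    then have "(l v* B - l) $ i = 0" for i
      using hpos[of i] lB_out[of i l] lout[of i]
      by (cases "i \<in> K") (metis less_irrefl, simp)
    then show ?thesis
      by (simp add: cart_eq_iff)
  qed
  have lpos: "0 < l $ j" if j: "j \<in> K" for j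
  proof -
    obtain i1 where i1: "0 < l $ i1"
      using l'(1) by (auto simp: l_def cart_eq_iff)
    then have "i1 \<in> K"
      using lout by force
    from access_class_path[OF K(1) this j] show ?thesis
    proof (induction rule: rtrancl_induct)
      case (step y z)
      then have "0 < l $ y * B $ y $ z"
        by (auto simp: digraph_of_matrix_def B_def truncation_def)
      also have "\<dots> \<le> (\<Sum>i\<in>UNIV. l $ i * B $ i $ z)"
        using l0 by (intro member_le_sum) (auto simp: B_def truncation_nonneg vec_le_iff)
      also have "\<dots> = l $ z"
        using arg_cong[OF leq, of "\<lambda>v. v $ z"] by (simp add: vector_matrix_mult_def)
      finally show ?case .
    qed (rule i1)
  qed
  have "\<exists>m. l \<le> m \<and> m v* P = m"
  proof (rule mono_iterates_fixed_point)
    show "mono (\<lambda>y. y v* P)"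
      by (auto intro!: monoI sum_mono mult_right_mono simp: vector_matrix_mult_def vec_le_iff nonneg)
    show "continuous_on UNIV (\<lambda>y. y v* P)"
      using matrix_vector_mult_linear_continuous_on[of UNIV "Finite_Cartesian_Product.transpose P"] by simp
    have "l v* B \<le> l v* P"
      using l0 by (auto simp: vec_le_iff vector_matrix_mult_def B_def truncation_def nonneg intro!: sum_mono)
    then show "l \<le> l v* P"
      by (simp add: leq)
    \<comment> \<open>Moving the powers to the other factor bounds the left orbit of l by the right
      orbit of the all-ones vector.\<close>
    have move: "((\<lambda>y. y v* P) ^^ k) l \<bullet> y = l \<bullet> ((\<lambda>x. P *v x) ^^ k) y" for k y
    proof (induction k arbitrary: y)
      case (Suc k)
      then show ?case
        by (simp only: funpow.simps(2) o_apply dot_lmul_matrix funpow_swap1[of "\<lambda>x. P *v x" k])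
    qed simp
    fix k
    show "((\<lambda>y. y v* P) ^^ k) l \<le> (l \<bullet> U) *\<^sub>R 1"
      unfolding vec_le_iff
    proof
      fix j
      have "axis j 1 \<le> (1 :: real ^ 'n)"
        by (simp add: vec_le_iff axis_def)
      then have "((\<lambda>x. P *v x) ^^ k) (axis j 1) \<le> ((\<lambda>x. P *v x) ^^ k) 1"
        using funpow_mono[OF mono_mult] by blast
      then have "((\<lambda>x. P *v x) ^^ k) (axis j 1) \<le> U"
        using powers_bounded order_trans by blast
      then have "l \<bullet> ((\<lambda>x. P *v x) ^^ k) (axis j 1) \<le> l \<bullet> U"
        by (rule inner_mono_vec[rotated]) (use l0 in \<open>simp add: vec_le_iff\<close>)
      moreover have "((\<lambda>y. y v* P) ^^ k) l \<bullet> axis j 1 = ((\<lambda>y. y v* P) ^^ k) l $ j"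
        by (simp add: inner_axis)
      ultimately show "((\<lambda>y. y v* P) ^^ k) l $ j \<le> ((l \<bullet> U) *\<^sub>R 1) $ j"
        by (simp add: move)
    qed
  qed blast
  then obtain m where "l \<le> m" "m v* P = m"
    by blast
  with h0 hpos hout h(2) l0 lpos lout leq show thesis
    unfolding B_def by (intro that)
qed

lemma critical_class_access: "K \<in> critical_classes P \<Longrightarrow> K \<in> access_classes (digraph_of_matrix P)"
  by (simp add: critical_classes_def)

text \<open>Excludes a single node without a loop, for which the block would be zero. It ensures
  that every critical node lies on a circuit.\<close>

lemma critical_class_successor:
  assumes K: "K \<in> critical_classes P" and i: "i \<in> K"
  shows "\<exists>j\<in>K. 0 < P $ i $ j"
proof (rule ccontr)
  assume "\<not> (\<exists>j\<in>K. 0 < P $ i $ j)"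
  then have zero: "P $ i $ j = 0" if "j \<in> K" for j
    using that nonneg[of i j] by force
  obtain h where h: "0 < h $ i" "truncation K *v h = h"
    using critical_class_eigenvectors[OF K] i by metis
  have "h $ i = (truncation K *v h) $ i"
    by (simp add: h(2))
  also have "\<dots> = 0"
    by (simp add: truncation_mult zero)
  finally show False
    using h(1) by simp
qed

text \<open>The vector h of \<open>K'\<close> satisfies \<open>h \<le> P *v h\<close>, and pairing
  with the invariant vector m of K forces equality wherever m is positive, in particular at i. But h
  vanishes at i, while the arc makes \<open>P *v h\<close> positive there.\<close>

lemma critical_classes_no_access:
  assumes K: "K \<in> critical_classes P" and i: "i \<in> K"
    and K': "K' \<in> critical_classes P" and j: "j \<in> K'" and arc: "0 < P $ i $ j"
  shows "K = K'"
proof (rule ccontr)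
  assume "K \<noteq> K'"
  then have i': "i \<notin> K'"
    using access_class_iff[OF critical_class_access[OF K] i]
      access_class_iff[OF critical_class_access[OF K'], of i] by blast
  obtain l m where l: "0 \<le> l" "\<And>i. i \<in> K \<Longrightarrow> 0 < l $ i" and m: "l \<le> m" "m v* P = m"
    using critical_class_eigenvectors[OF K] by metis
  obtain h where h0: "0 \<le> h" and h: "\<And>i. i \<in> K' \<Longrightarrow> 0 < h $ i"
      "\<And>i. i \<notin> K' \<Longrightarrow> h $ i = 0" "truncation K' *v h = h"
    using critical_class_eigenvectors[OF K'] by metis
  have m0: "0 \<le> m $ k" for k
    using order_trans[OF l(1) m(1)] by (simp add: vec_le_iff)
  have le: "h \<le> P *v h"
    using truncation_le[OF h0, of K'] by (simp add: h(3))
  have "m \<bullet> (P *v h - h) = 0"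
    by (simp add: inner_diff_right dot_lmul_matrix[symmetric] m(2))
  then have "(\<Sum>k\<in>UNIV. m $ k * (P *v h - h) $ k) = 0"
    by (simp add: inner_vec_def)
  moreover have "0 \<le> m $ k * (P *v h - h) $ k" for k
    using le m0 by (simp add: vec_le_iff)
  ultimately have "m $ i * (P *v h - h) $ i = 0"
    by (simp add: sum_nonneg_eq_0_iff)
  moreover have "0 < m $ i"
    using l(2)[OF i] m(1) by (auto simp: vec_le_iff intro: less_le_trans)
  ultimately have "(P *v h) $ i = 0"
    using h(2)[OF i'] by simp
  moreover have "0 < P $ i $ j * h $ j"
    using arc h(1)[OF j] by simp
  moreover have "P $ i $ j * h $ j \<le> (P *v h) $ i"
  proof -
    have "P $ i $ j * h $ j \<le> (\<Sum>j\<in>UNIV. P $ i $ j * h $ j)"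
      using h0 by (intro member_le_sum) (auto simp: nonneg vec_le_iff)
    then show ?thesis
      by (simp add: matrix_vector_mult_def)
  qed
  ultimately show False
    by linarith
qed

text \<open>\<open>critical_digraph\<close> keeps all arcs between critical nodes; those between
  different critical classes have just been ruled out.\<close>

lemma critical_digraph_iff:
  "(i, j) \<in> critical_digraph P \<longleftrightarrow> (\<exists>K \<in> critical_classes P. i \<in> K \<and> j \<in> K \<and> 0 < P $ i $ j)"
  unfolding critical_digraph_def digraph_of_matrix_def critical_nodes_def
  using critical_classes_no_access[of _ i _ j] by blast

text \<open>A class of the support that no other class of the support has access to is critical.\<close>

lemma left_eigenvector_critical_class:
  assumes M: "0 \<le> M" "M \<noteq> 0" "M v* P = M"
  shows "\<exists>K \<in> critical_classes P. \<exists>i\<in>K. M $ i \<noteq> 0"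
proof -
  define E where "E = digraph_of_matrix P"
  define S where "S = {i. 0 < M $ i}"
  have S: "M $ i = 0 \<longleftrightarrow> i \<notin> S" for i
    using M(1) by (auto simp: S_def vec_le_iff order_le_less)
  have "S \<noteq> {}"
    using M(2) S by (auto simp: cart_eq_iff)
  \<comment> \<open>A node of the support that reaches the most nodes: any node of the support with
    access to it reaches exactly the same nodes, hence belongs to its class.\<close>
  then have "Max ((\<lambda>k. card (E\<^sup>* `` {k})) ` S) \<in> (\<lambda>k. card (E\<^sup>* `` {k})) ` S"
    by (intro Max_in) auto
  then obtain i where i: "i \<in> S" "card (E\<^sup>* `` {i}) = Max ((\<lambda>k. card (E\<^sup>* `` {k})) ` S)"
    by auto
  have returns: "(i, k) \<in> E\<^sup>*" if "k \<in> S" "(k, i) \<in> E\<^sup>*" for k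
  proof -
    have "E\<^sup>* `` {i} \<subseteq> E\<^sup>* `` {k}"
      using that(2) by (auto intro: rtrancl_trans)
    then have "E\<^sup>* `` {i} = E\<^sup>* `` {k}"
      unfolding i(2) using that(1) by (intro card_seteq) (auto simp: i(2))
    then show ?thesis
      by auto
  qed
  obtain K where K: "K \<in> access_classes E" "i \<in> K"
    using access_class_exists[of E i] by blast
  have closed: "k \<in> K" if "k \<in> S" "0 < P $ k $ j" "j \<in> K" for k j
  proof -
    have "(j, i) \<in> E\<^sup>*"
      using access_class_iff[OF K, of j] that(3) by blast
    moreover have "(k, j) \<in> E"
      using that by (simp add: E_def digraph_of_matrix_def)
    ultimately have "(k, i) \<in> E\<^sup>*"
      by (meson converse_rtrancl_into_rtrancl)
    then show ?thesis
      using access_class_iff[OF K, of k] returns[OF that(1)] by blast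
  qed
  define M' where "M' = (\<chi> k. if k \<in> K then M $ k else 0)"
  have M'B: "M' v* truncation K = M'"
    unfolding cart_eq_iff
  proof
    fix j
    show "(M' v* truncation K) $ j = M' $ j"
    proof (cases "j \<in> K")
      case True
      \<comment> \<open>For k outside K both sides vanish: an arc from the support into K would put
        k into K.\<close>
      have "M' $ k * truncation K $ k $ j = M $ k * P $ k $ j" for k
        using closed[of k j] True S[of k] nonneg[of k j]
        by (auto simp: M'_def truncation_def order_le_less)
      then have "(M' v* truncation K) $ j = (M v* P) $ j"
        by (simp add: vector_matrix_mult_def)
      then show ?thesis
        using True M(3) by (simp add: M'_def)
    qed (simp add: M'_def vector_matrix_mult_def truncation_def)
  qed
  have "M' $ i \<noteq> 0"
    using i(1) K(2) S by (auto simp: M'_def)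
  then have "M' \<noteq> 0"
    by (auto simp: cart_eq_iff)
  \<comment> \<open>The eigenvalue criterion speaks of right eigenvectors, so the left eigenvector
    \<open>M'\<close> is traded for one by transposing.\<close>
  have "\<exists>x. x \<noteq> 0 \<and> truncation K *v x = x"
  proof (rule ccontr)
    assume "\<nexists>x. x \<noteq> 0 \<and> truncation K *v x = x"
    then have "invertible (truncation K - Finite_Cartesian_Product.mat 1)"
      by (subst invertible_left_inverse, subst matrix_left_invertible_ker)
        (auto simp: matrix_vector_mult_diff_rdistrib)
    then have "invertible (Finite_Cartesian_Product.transpose (truncation K - Finite_Cartesian_Product.mat 1))"
      by (rule transpose_invertible)
    then have "M' = 0"
      using M'B unfolding invertible_left_inverse matrix_left_invertible_ker
      by (simp add: vector_matrix_mult_diff_rdistrib)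
    with \<open>M' \<noteq> 0\<close> show False by simp
  qed
  then obtain x where x: "x \<noteq> 0" "truncation K *v x = x"
    by blast
  then have x': "x $ k = (if k \<in> K then \<Sum>j\<in>K. P $ k $ j * x $ j else 0)" for k
    using truncation_mult[of K x k] by simp
  have "eigenvalue (principal_submatrix P K) 1"
    unfolding eigenvalue_principal_submatrix
  proof (intro exI[of _ "\<lambda>k. complex_of_real (x $ k)"] conjI ballI)
    show "\<exists>i\<in>K. complex_of_real (x $ i) \<noteq> 0"
    proof -
      obtain k where "x $ k \<noteq> 0"
        using x(1) by (auto simp: cart_eq_iff)
      then show ?thesis
        using x'[of k] by (intro bexI[of _ k]) (auto split: if_splits)
    qed
    fix k assume "k \<in> K"
    then show "(\<Sum>j\<in>K. complex_of_real (P $ k $ j) * complex_of_real (x $ j)) = 1 * complex_of_real (x $ k)"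
      using x'[of k] by (simp flip: of_real_mult of_real_sum)
  qed
  then have "K \<in> critical_classes P"
    using K(1) by (intro critical_classI) (auto simp: E_def)
  then show ?thesis
    using K(2) i(1) S by blast
qed

end

section \<open>Convex monotone maps with dominated differences\<close>

text \<open>A hyperplane separates the strict epigraph of g from the point \<open>(y, g y)\<close>;
  it is not vertical because the epigraph lies over the whole space, and its slope is q.\<close>

lemma convex_subgradient_exists:
  fixes g :: "'a::euclidean_space \<Rightarrow> real"
  assumes "convex_on UNIV g"
  shows "\<exists>q. \<forall>x. q \<bullet> (x - y) \<le> g x - g y"
proof -
  define S where "S = {(x, t). g x < t}"
  have "convex S"
  proof (rule convexI, clarsimp simp: S_def)
    fix x t x' t' :: _ and u v :: real
    assume *: "g x < t" "g x' < t'" "0 \<le> u" "0 \<le> v" "u + v = 1"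
    have "g (u *\<^sub>R x + v *\<^sub>R x') \<le> u * g x + v * g x'"
      using assms * unfolding convex_on_def by blast
    also have "\<dots> < u * t + v * t'"
      using * by (cases "u = 0") (auto intro!: add_less_le_mono mult_left_mono)
    finally show "g (u *\<^sub>R x + v *\<^sub>R x') < u * t + v * t'" .
  qed
  moreover have "(y, g y + 1) \<in> S"
    by (simp add: S_def)
  then have "S \<noteq> {}"
    by blast
  moreover have "S \<inter> {(y, g y)} = {}"
    by (auto simp: S_def)
  ultimately obtain p b where p: "p \<noteq> 0" "\<forall>s\<in>S. p \<bullet> s \<le> b" "b \<le> p \<bullet> (y, g y)"
    using separating_hyperplane_sets[of S "{(y, g y)}"] by auto
  obtain a c where ac: "p = (a, c)"
    by (cases p)
  have sep: "a \<bullet> x + c * t \<le> a \<bullet> y + c * g y" if "g x < t" for x t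
    using p(2,3) that by (force simp: ac S_def)
  have "c \<le> 0"
    using sep[of y "g y + 1"] by (simp add: algebra_simps)
  moreover have "c \<noteq> 0"
  proof
    assume "c = 0"
    then have "a \<bullet> a \<le> 0"
      using sep[of "y + a" "g (y + a) + 1"] by (simp add: inner_add_right)
    then have "a = 0"
      by (metis inner_gt_zero_iff not_less)
    then show False
      using p(1) \<open>c = 0\<close> by (simp add: ac zero_prod_def)
  qed
  ultimately have c: "c < 0" by simp
  have "a \<bullet> (x - y) \<le> - c * (g x - g y)" for x
  proof (rule field_le_epsilon)
    fix e :: real assume "0 < e"
    then have "g x < g x + e / (- c)"
      using c by (simp add: divide_simps)
    from sep[OF this] c show "a \<bullet> (x - y) \<le> - c * (g x - g y) + e"
      by (simp add: algebra_simps inner_diff_right)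
  qed
  then have "(a /\<^sub>R (- c)) \<bullet> (x - y) \<le> g x - g y" for x
    using c by (simp add: field_simps)
  then show ?thesis
    by blast
qed

lemma vec_abs_le_norm: "x \<le> norm x *\<^sub>R (1 :: real ^ 'n)"
  using component_le_norm_cart[of x] by (auto simp: vec_le_iff abs_le_iff)

text \<open>In the application, \<open>G\<close> is the recession map of \<open>F\<close>.\<close>

locale dominated_convex_map =
  fixes F G :: "real ^ 'n \<Rightarrow> real ^ 'n" and U :: "real ^ 'n"
  assumes F_0: "F 0 = 0"
    and F_mono: "mono F"
    and F_convex: "convex_map F"
    and F_diff: "F x - F y \<le> G (x - y)"
    and G_mono: "mono G"
    and G_scale: "0 < a \<Longrightarrow> G (a *\<^sub>R x) = a *\<^sub>R G x"
    and G_bounded: "(G ^^ k) 1 \<le> U"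
begin

lemma G_iterate_mono: "x \<le> y \<Longrightarrow> (G ^^ k) x \<le> (G ^^ k) y"
  using funpow_mono[OF G_mono] by blast

lemma G_0: "G 0 = 0"
  using G_scale[of 2 0] by (simp add: cart_eq_iff)

lemma G_iterate_scale: "0 \<le> a \<Longrightarrow> (G ^^ k) (a *\<^sub>R x) = a *\<^sub>R (G ^^ k) x"
  by (induction k) (auto simp: G_scale G_0 order_le_less)

lemma F_iterate_0: "(F ^^ k) 0 = 0"
  by (induction k) (simp_all add: F_0)

lemma F_iterate_diff: "(F ^^ k) x - (F ^^ k) y \<le> (G ^^ k) (x - y)"
proof (induction k)
  case (Suc k)
  have "F ((F ^^ k) x) - F ((F ^^ k) y) \<le> G ((F ^^ k) x - (F ^^ k) y)"
    by (rule F_diff)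
  also have "\<dots> \<le> G ((G ^^ k) (x - y))"
    by (rule monoD[OF G_mono Suc])
  finally show ?case
    by simp
qed simp

lemma G_iterate_le: "(G ^^ k) x \<le> norm x *\<^sub>R U"
proof -
  have "(G ^^ k) x \<le> norm x *\<^sub>R (G ^^ k) 1"
    using G_iterate_mono[OF vec_abs_le_norm, of k x] by (simp add: G_iterate_scale)
  also have "\<dots> \<le> norm x *\<^sub>R U"
    using G_bounded[of k] by (auto simp: vec_le_iff intro: mult_left_mono)
  finally show ?thesis .
qed

lemma U_ge_1: "1 \<le> U $ i"
  using G_bounded[of 0] by (simp add: vec_le_iff)

lemma U_pos: "0 < U $ i"
  using U_ge_1[of i] by linarith

text \<open>A Lipschitz constant for all iterates of F at once; the sum appears because the
  Euclidean norm is bounded by the sum of the moduli.\<close>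

definition lip :: real where
  "lip = (\<Sum>i\<in>UNIV. U $ i)"

lemma lip_pos: "0 < lip"
  unfolding lip_def by (rule sum_pos) (auto simp: U_pos)

text \<open>The bound from G is one-sided; exchanging x and y makes it two-sided.\<close>

lemma F_iterate_lipschitz: "dist ((F ^^ k) x) ((F ^^ k) y) \<le> lip * dist x y"
proof -
  have le: "((F ^^ k) x - (F ^^ k) y) $ i \<le> norm (x - y) * U $ i" for x y i
    using order_trans[OF F_iterate_diff G_iterate_le, of k x y] by (simp add: vec_le_iff)
  have "\<bar>((F ^^ k) x - (F ^^ k) y) $ i\<bar> \<le> norm (x - y) * U $ i" for i
    using le[of x y i] le[of y x i] by (simp add: norm_minus_commute abs_le_iff)
  then have "(\<Sum>i\<in>UNIV. \<bar>((F ^^ k) x - (F ^^ k) y) $ i\<bar>) \<le> (\<Sum>i\<in>UNIV. norm (x - y) * U $ i)"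
    by (intro sum_mono)
  then show ?thesis
    unfolding dist_norm lip_def using norm_le_l1_cart[of "(F ^^ k) x - (F ^^ k) y"]
    by (simp add: sum_distrib_right mult.commute)
qed

lemma F_iterate_norm_le: "norm ((F ^^ k) x) \<le> lip * norm x"
  using F_iterate_lipschitz[of k x 0] by (simp add: F_iterate_0)

lemma F_iterate_continuous: "continuous_on UNIV (F ^^ k)"
  by (rule lipschitz_on_continuous_on[of lip], rule lipschitz_onI)
    (simp_all add: F_iterate_lipschitz lip_pos less_imp_le)

lemma subdifferential_nonempty: "subdifferential F y \<noteq> {}"
proof -
  have "\<exists>q. \<forall>x. q \<bullet> (x - y) \<le> F x $ i - F y $ i" for i
    using F_convex by (intro convex_subgradient_exists) (simp add: convex_map_def)
  then obtain q where q: "\<And>i x. q i \<bullet> (x - y) \<le> F x $ i - F y $ i"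
    by metis
  then have "(\<chi> i. q i) \<in> subdifferential F y"
    by (simp add: subdifferential_def vec_le_iff matrix_vector_mult_def inner_vec_def)
  then show ?thesis
    by blast
qed

lemma subgradientD: "Q \<in> subdifferential F y \<Longrightarrow> Q *v (x - y) \<le> F x - F y"
  by (simp add: subdifferential_def)

lemma subgradient_le_G:
  assumes "Q \<in> subdifferential F y"
  shows "Q *v x \<le> G x"
  using subgradientD[OF assms, of "y + x"] F_diff[of "y + x" y] by simp

text \<open>The subgradient inequality at a unit step down in coordinate j bounds minus column j by
  a difference that monotonicity makes nonpositive.\<close>

lemma subgradient_nonneg:
  assumes "Q \<in> subdifferential F y"
  shows "0 \<le> Q $ i $ j"
proof -
  have "y - axis j 1 \<le> y"
    by (simp add: vec_le_iff axis_def)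
  then have "F (y - axis j 1) \<le> F y"
    by (rule monoD[OF F_mono])
  moreover have "Q *v (- axis j 1) \<le> F (y - axis j 1) - F y"
    using subgradientD[OF assms, of "y - axis j 1"] by simp
  ultimately have "(Q *v (- axis j 1)) $ i \<le> 0"
    unfolding vec_le_iff by (metis diff_le_0_iff_le order_trans vector_minus_component)
  moreover have "(Q *v (- axis j 1)) $ i = - (Q $ i $ j)"
    by (simp add: matrix_vector_mult_def axis_def sum_negf if_distrib[of "\<lambda>x. _ * x"] cong: if_cong)
  ultimately show ?thesis
    by simp
qed

text \<open>Powers of P on the all-ones vector stay below those of G, so a single U serves for all
  subgradients at 0.\<close>

lemma subgradient_stable:
  assumes "P \<in> subdifferential F 0"
  shows "stable_matrix P U"
proof
  have mono: "mono (\<lambda>x. P *v x)"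
    by (rule monoI) (rule matrix_vector_mono[OF subgradient_nonneg[OF assms]])
  fix k
  have "((\<lambda>x. P *v x) ^^ k) 1 \<le> (G ^^ k) 1"
  proof (induction k)
    case (Suc k)
    then have "P *v ((\<lambda>x. P *v x) ^^ k) 1 \<le> P *v (G ^^ k) 1"
      by (rule monoD[OF mono])
    also have "\<dots> \<le> G ((G ^^ k) 1)"
      by (rule subgradient_le_G[OF assms])
    finally show ?case
      by simp
  qed simp
  with G_bounded[of k] show "((\<lambda>x. P *v x) ^^ k) 1 \<le> U"
    by (rule order_trans[rotated])
qed (rule subgradient_nonneg[OF assms])

end

section \<open>Recurrent points on the critical nodes\<close>

text \<open>Equality case of the monotone pairing. It is the device that turns a conserved quantity
  into equality in each coordinate of positive weight.\<close>

lemma inner_eq_nonneg_imp: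
  fixes m x y :: "real ^ 'n"
  assumes "\<And>i. 0 \<le> m $ i" "\<And>i. 0 < m $ i \<Longrightarrow> x $ i \<le> y $ i" "m \<bullet> x = m \<bullet> y" "0 < m $ i"
  shows "x $ i = y $ i"
proof -
  have "(\<Sum>i\<in>UNIV. m $ i * (y $ i - x $ i)) = 0"
    using assms(3) by (simp add: inner_vec_def right_diff_distrib sum_subtractf)
  moreover have "0 \<le> m $ i * (y $ i - x $ i)" for i
    using assms(1,2)[of i] by (cases "m $ i = 0") auto
  ultimately have "m $ i * (y $ i - x $ i) = 0"
    by (simp add: sum_nonneg_eq_0_iff)
  then show ?thesis
    using assms(4) by simp
qed

lemma inner_mono_support:
  fixes m x y :: "real ^ 'n"
  assumes "\<And>i. 0 \<le> m $ i" "\<And>i. 0 < m $ i \<Longrightarrow> x $ i \<le> y $ i"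
  shows "m \<bullet> x \<le> m \<bullet> y"
  unfolding inner_vec_def
proof (rule sum_mono)
  fix i
  show "m $ i \<bullet> x $ i \<le> m $ i \<bullet> y $ i"
    using assms(1,2)[of i] by (cases "m $ i = 0") (auto intro: mult_left_mono)
qed

lemma abs_vec_nth [simp]: "\<bar>x :: real ^ 'n\<bar> $ i = \<bar>x $ i\<bar>"
  by (simp add: abs_vec_def)

lemma abs_mult_vec_le:
  fixes A :: "real ^ 'n ^ 'm"
  assumes "\<And>i j. 0 \<le> A $ i $ j"
  shows "\<bar>A *v x\<bar> \<le> A *v \<bar>x\<bar>"
  unfolding vec_le_iff
proof
  fix i
  have "\<bar>\<Sum>j\<in>UNIV. A $ i $ j * x $ j\<bar> \<le> (\<Sum>j\<in>UNIV. \<bar>A $ i $ j * x $ j\<bar>)"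
    by (rule sum_abs)
  then show "\<bar>A *v x\<bar> $ i \<le> (A *v \<bar>x\<bar>) $ i"
    by (simp add: matrix_vector_mult_def abs_mult assms)
qed

context dominated_convex_map
begin

text \<open>The return times are part of the notion, so that two points can be required to return
  simultaneously; a point and its iterates share them.\<close>

definition recurrent_along :: "(nat \<Rightarrow> nat) \<Rightarrow> real ^ 'n \<Rightarrow> bool" where
  "recurrent_along d y \<longleftrightarrow> filterlim d at_top sequentially \<and> (\<lambda>k. (F ^^ d k) y) \<longlonglongrightarrow> y"

lemma recurrent_iterate:
  assumes "recurrent_along d y"
  shows "recurrent_along d ((F ^^ s) y)"
proof -
  have "(\<lambda>k. (F ^^ s) ((F ^^ d k) y)) \<longlonglongrightarrow> (F ^^ s) y"
    using assms F_iterate_continuous[of s]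
    by (auto simp: recurrent_along_def intro: continuous_on_tendsto_compose)
  moreover have "(F ^^ s) ((F ^^ d k) y) = (F ^^ d k) ((F ^^ s) y)" for k
    by (metis add.commute comp_apply funpow_add)
  ultimately show ?thesis
    using assms by (simp add: recurrent_along_def)
qed

lemma recurrent_step: "recurrent_along d y \<Longrightarrow> recurrent_along d (F y)"
  using recurrent_iterate[of d y 1] by simp

text \<open>Along the orbit \<phi> increases, yet it comes back arbitrarily close to its initial
  value, so it cannot have grown. Monotonicity is demanded only at recurrent points because for some
  later choices of \<phi> it is known only there.\<close>

lemma recurrent_mono_const:
  fixes \<phi> :: "real ^ 'n \<Rightarrow> real"
  assumes rec: "recurrent_along d y" and cont: "continuous_on UNIV \<phi>"
    and mono: "\<And>x. recurrent_along d x \<Longrightarrow> \<phi> x \<le> \<phi> (F x)"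
  shows "\<phi> (F y) = \<phi> y"
proof -
  have inc: "incseq (\<lambda>k. \<phi> ((F ^^ k) y))"
    using mono[OF recurrent_iterate[OF rec]] by (auto intro: incseq_SucI)
  have "(\<lambda>k. \<phi> ((F ^^ d k) y)) \<longlonglongrightarrow> \<phi> y"
    using rec cont by (auto simp: recurrent_along_def intro: continuous_on_tendsto_compose)
  moreover have "eventually (\<lambda>k. 1 \<le> d k) sequentially"
    using rec by (auto simp: recurrent_along_def filterlim_at_top)
  then have "eventually (\<lambda>k. \<phi> (F y) \<le> \<phi> ((F ^^ d k) y)) sequentially"
    by eventually_elim (use incseqD[OF inc, of 1] in auto)
  ultimately have "\<phi> (F y) \<le> \<phi> y"
    by (rule tendsto_lowerbound) simp
  with mono[OF rec] show ?thesis
    by simp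
qed

lemma recurrent_anti_const:
  fixes \<phi> :: "real ^ 'n \<Rightarrow> real"
  assumes "recurrent_along d y" "continuous_on UNIV \<phi>"
    "\<And>x. recurrent_along d x \<Longrightarrow> \<phi> (F x) \<le> \<phi> x"
  shows "\<phi> (F y) = \<phi> y"
  using recurrent_mono_const[of d y "\<lambda>x. - \<phi> x"] assms by (auto intro: continuous_on_minus)

lemma subgradient_0_le: "P \<in> subdifferential F 0 \<Longrightarrow> P *v x \<le> F x"
  using subgradientD[of P 0 x] by (simp add: F_0)

lemma continuous_on_inner_abs: "continuous_on UNIV (\<lambda>x. m \<bullet> \<bar>x - a\<bar>)" for m a :: "real ^ 'n"
  unfolding abs_vec_def by (intro continuous_intros)

text \<open>Three conserved quantities are used in turn. \<open>m \<bullet> x\<close> cannot fall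
  under F since \<open>P *v x \<le> F x\<close>; its constancy makes F linear on the support of m.
  Then \<open>m \<bullet> \<bar>x\<bar>\<close> cannot grow, and its constancy says that no
  cancellation occurs there. Finally \<open>l \<bullet> \<bar>x\<bar>\<close> cannot fall, and its
  constancy leaves \<open>l v* P\<close> without excess over l wherever y is nonzero: no arc from K
  leads to a nonzero coordinate outside K.\<close>

lemma recurrent_critical_row:
  assumes P: "P \<in> subdifferential F 0" and K: "K \<in> critical_classes P"
    and rec: "recurrent_along d y" and i: "i \<in> K"
  shows "F y $ i = (P *v y) $ i" and "j \<notin> K \<Longrightarrow> P $ i $ j * y $ j = 0"
proof -
  interpret stable_matrix P U
    by (rule subgradient_stable[OF P])
  obtain l m where l0: "0 \<le> l" and l: "\<And>i. i \<in> K \<Longrightarrow> 0 < l $ i" "\<And>i. i \<notin> K \<Longrightarrow> l $ i = 0"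
      "l v* truncation K = l" and m: "l \<le> m" "m v* P = m"
    using critical_class_eigenvectors[OF K] by metis
  have m0: "0 \<le> m $ k" for k
    using order_trans[OF l0 m(1)] by (simp add: vec_le_iff)
  have mpos: "0 < m $ k" if "k \<in> K" for k
    using l(1)[OF that] m(1) by (auto simp: vec_le_iff intro: less_le_trans)
  have lpos: "k \<in> K" if "0 < l $ k" for k
    using l(2)[of k] that by force
  have invariant: "m \<bullet> (P *v x) = m \<bullet> x" for x
    by (simp add: dot_lmul_matrix[symmetric] m(2))
  have "m \<bullet> F x = m \<bullet> x" if "recurrent_along d x" for x
    using that
  proof (rule recurrent_mono_const)
    show "m \<bullet> x \<le> m \<bullet> F x" for x
      using inner_mono_vec[OF m0 subgradient_0_le[OF P, of x]] by (simp add: invariant)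
  qed (intro continuous_intros)
  then have linear: "F x $ k = (P *v x) $ k" if "recurrent_along d x" "0 < m $ k" for x k
    using that inner_eq_nonneg_imp[of m "P *v x" "F x" k] m0 subgradient_0_le[OF P, of x]
    by (simp add: invariant vec_le_iff)
  show "F y $ i = (P *v y) $ i"
    by (rule linear[OF rec mpos[OF i]])
  have abs_le: "\<bar>F x\<bar> $ k \<le> (P *v \<bar>x\<bar>) $ k" if "recurrent_along d x" "0 < m $ k" for x k
    using abs_mult_vec_le[of P x] nonneg linear[OF that] by (simp add: vec_le_iff)
  have "m \<bullet> \<bar>F x\<bar> = m \<bullet> \<bar>x\<bar>" if "recurrent_along d x" for x
    using that
  proof (rule recurrent_anti_const)
    show "m \<bullet> \<bar>F x\<bar> \<le> m \<bullet> \<bar>x\<bar>" if "recurrent_along d x" for x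
      using inner_mono_support[of m, OF m0 abs_le[OF that]] by (simp add: invariant)
  qed (use continuous_on_inner_abs[of m 0] in simp)
  then have abs_linear: "\<bar>F x\<bar> $ k = (P *v \<bar>x\<bar>) $ k" if "recurrent_along d x" "0 < m $ k" for x k
    using that abs_le[OF that(1)] by (intro inner_eq_nonneg_imp[of m, OF m0]) (simp_all add: invariant)
  have l_abs: "l \<bullet> \<bar>F x\<bar> = (l v* P) \<bullet> \<bar>x\<bar>" if "recurrent_along d x" for x
  proof -
    have "l $ k * \<bar>F x\<bar> $ k = l $ k * (P *v \<bar>x\<bar>) $ k" for k
      using abs_linear[OF that mpos, of k] l(2)[of k] by (cases "k \<in> K") auto
    then show ?thesis
      unfolding dot_lmul_matrix by (simp only: inner_vec_def inner_real_def)
  qed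
  have lP: "l \<le> l v* P"
  proof -
    have "l v* truncation K \<le> l v* P"
      using l0 by (auto simp: vec_le_iff vector_matrix_mult_def truncation_def nonneg intro!: sum_mono)
    then show ?thesis
      by (simp add: l(3))
  qed
  have "l \<bullet> \<bar>F y\<bar> = l \<bullet> \<bar>y\<bar>"
    using rec
  proof (rule recurrent_mono_const)
    fix x assume "recurrent_along d x"
    then have "l \<bullet> \<bar>F x\<bar> = \<bar>x\<bar> \<bullet> (l v* P)"
      by (simp add: l_abs inner_commute)
    moreover have "\<bar>x\<bar> \<bullet> l \<le> \<bar>x\<bar> \<bullet> (l v* P)"
      using lP by (intro inner_mono_vec) auto
    ultimately show "l \<bullet> \<bar>x\<bar> \<le> l \<bullet> \<bar>F x\<bar>"
      by (simp add: inner_commute)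
  qed (use continuous_on_inner_abs[of l 0] in simp)
  then have eq: "\<bar>y\<bar> \<bullet> l = \<bar>y\<bar> \<bullet> (l v* P)"
    using l_abs[OF rec] by (simp add: inner_commute)
  assume j: "j \<notin> K"
  show "P $ i $ j * y $ j = 0"
  proof (cases "y $ j = 0")
    case False
    then have "0 = (l v* P) $ j"
      using inner_eq_nonneg_imp[OF _ _ eq, of j] lP l(2)[OF j] by (simp add: vec_le_iff)
    moreover have "l $ i * P $ i $ j \<le> (l v* P) $ j"
    proof -
      have "l $ i * P $ i $ j \<le> (\<Sum>k\<in>UNIV. l $ k * P $ k $ j)"
        using l0 by (intro member_le_sum[of i UNIV "\<lambda>k. l $ k * P $ k $ j"]) (auto simp: nonneg vec_le_iff)
      then show ?thesis
        by (simp add: vector_matrix_mult_def)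
    qed
    ultimately have "l $ i * P $ i $ j \<le> 0"
      by simp
    then show ?thesis
      using l(1)[OF i] nonneg[of i j] by (simp add: mult_le_0_iff)
  qed simp
qed

text \<open>The displacement from the multiple of \<open>h\<close> that agrees with \<open>F y\<close> at \<open>i\<close> evolves without
  cancellation, so it vanishes at all successors of \<open>i\<close>.\<close>

lemma recurrent_critical_arc:
  assumes P: "P \<in> subdifferential F 0" and K: "K \<in> critical_classes P"
    and h: "\<And>i. i \<in> K \<Longrightarrow> 0 < h $ i" "stable_matrix.truncation P K *v h = h"
    and rec: "recurrent_along d y" and ij: "i \<in> K" "j \<in> K" "0 < P $ i $ j"
  shows "F y $ i = h $ i / h $ j * y $ j"
proof -
  interpret stable_matrix P U
    by (rule subgradient_stable[OF P])
  obtain l where l0: "0 \<le> l" and l: "\<And>i. i \<in> K \<Longrightarrow> 0 < l $ i" "\<And>i. i \<notin> K \<Longrightarrow> l $ i = 0"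
      "l v* truncation K = l"
    using critical_class_eigenvectors[OF K] by metis
  have lK: "k \<in> K" if "0 < l $ k" for k
    using l(2)[of k] that by force
  have invariant: "l \<bullet> (truncation K *v x) = l \<bullet> x" for x
    by (simp add: dot_lmul_matrix[symmetric] l(3))
  define a where "a = F y $ i / h $ i"
  have step: "(F x - a *\<^sub>R h) $ k = (truncation K *v (x - a *\<^sub>R h)) $ k"
    if "recurrent_along d x" "k \<in> K" for x k
  proof -
    have "F x $ k = (\<Sum>j\<in>UNIV. P $ k $ j * x $ j)"
      using recurrent_critical_row(1)[OF P K that] by (simp add: matrix_vector_mult_def)
    also have "\<dots> = (\<Sum>j\<in>K. P $ k $ j * x $ j)"
      using recurrent_critical_row(2)[OF P K that] by (intro sum.mono_neutral_right) auto
    also have "\<dots> = (truncation K *v x) $ k"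
      using that(2) by (simp add: truncation_mult)
    finally show ?thesis
      by (simp add: matrix_vector_mult_diff_distrib matrix_vector_mult_scaleR h(2))
  qed
  have abs_le: "\<bar>F x - a *\<^sub>R h\<bar> $ k \<le> (truncation K *v \<bar>x - a *\<^sub>R h\<bar>) $ k"
    if "recurrent_along d x" "k \<in> K" for x k
    using abs_mult_vec_le[of "truncation K" "x - a *\<^sub>R h"] step[OF that]
    by (simp add: vec_le_iff truncation_nonneg)
  have "l \<bullet> \<bar>F y - a *\<^sub>R h\<bar> = l \<bullet> \<bar>y - a *\<^sub>R h\<bar>"
    using rec
  proof (rule recurrent_anti_const[where \<phi> = "\<lambda>x. l \<bullet> \<bar>x - a *\<^sub>R h\<bar>"])
    fix x assume "recurrent_along d x"
    then have "l \<bullet> \<bar>F x - a *\<^sub>R h\<bar> \<le> l \<bullet> (truncation K *v \<bar>x - a *\<^sub>R h\<bar>)"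
      using l0 abs_le lK by (intro inner_mono_support) (auto simp: vec_le_iff)
    then show "l \<bullet> \<bar>F x - a *\<^sub>R h\<bar> \<le> l \<bullet> \<bar>x - a *\<^sub>R h\<bar>"
      by (simp add: invariant)
  qed (rule continuous_on_inner_abs)
  then have "\<bar>F y - a *\<^sub>R h\<bar> $ i = (truncation K *v \<bar>y - a *\<^sub>R h\<bar>) $ i"
    using l0 abs_le[OF rec] lK l(1)[OF ij(1)]
    by (intro inner_eq_nonneg_imp[of l]) (auto simp: vec_le_iff invariant)
  moreover have "(F y - a *\<^sub>R h) $ i = 0"
    using h(1)[OF ij(1)] by (simp add: a_def)
  ultimately have "(\<Sum>j\<in>K. P $ i $ j * \<bar>(y - a *\<^sub>R h) $ j\<bar>) = 0"
    using ij(1) by (simp add: truncation_mult)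
  then have "P $ i $ j * \<bar>(y - a *\<^sub>R h) $ j\<bar> = 0"
    using ij(2) by (subst (asm) sum_nonneg_eq_0_iff) (auto simp: nonneg)
  then have "y $ j = a * h $ j"
    using ij(3) by simp
  then show ?thesis
    using h(1)[OF ij(1)] h(1)[OF ij(2)] by (simp add: a_def field_simps)
qed

end

section \<open>Arithmetic of periods and cyclicity\<close>

lemma Gcd_mem_numerical:
  fixes S A :: "nat set"
  assumes zero: "0 \<in> S" and add: "\<And>s t. s \<in> S \<Longrightarrow> t \<in> S \<Longrightarrow> s + t \<in> S"
    and cancel: "\<And>s t. s \<in> S \<Longrightarrow> s + t \<in> S \<Longrightarrow> t \<in> S" and sub: "A \<subseteq> S"
  shows "Gcd A \<in> S"
proof (cases "S \<subseteq> {0}")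
  case True
  then have "Gcd A = 0"
    using sub by (auto simp: Gcd_0_iff)
  show ?thesis
    unfolding \<open>Gcd A = 0\<close> by (rule zero)
next
  case False
  define p where "p = (LEAST p. p \<in> S \<and> 0 < p)"
  obtain s where "s \<in> S" "0 < s"
    using False by auto
  then have p: "p \<in> S \<and> 0 < p"
    unfolding p_def using LeastI[of "\<lambda>p. p \<in> S \<and> 0 < p" s] by blast
  have mult: "q * p \<in> S" for q
  proof (induction q)
    case (Suc q)
    then show ?case
      using add[of p "q * p"] p by simp
  qed (simp add: zero)
  \<comment> \<open>Cancelling a multiple of p leaves the remainder in S, so minimality of p makes
    it 0. Hence S consists exactly of the multiples of p.\<close>
  have p_dvd: "p dvd s" if "s \<in> S" for s
  proof -
    have "s mod p \<in> S"
      using cancel[OF mult[of "s div p"], of "s mod p"] that by simp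
    moreover have "\<not> (s mod p \<in> S \<and> 0 < s mod p)"
      using not_less_Least[of "s mod p" "\<lambda>p. p \<in> S \<and> 0 < p"] p by (simp add: p_def)
    ultimately show ?thesis
      by (simp add: dvd_eq_mod_eq_0)
  qed
  then have "p dvd Gcd A"
    using sub p_dvd by (intro Gcd_greatest) blast
  then obtain q where "Gcd A = p * q"
    by (rule dvdE)
  with mult[of q] show ?thesis
    by (simp only: mult.commute)
qed

text \<open>There are finitely many classes, which matters because the Lcm of an infinite set of
  naturals is 0; and each gcd is positive because circuits have positive length.\<close>

lemma cyclicity_pos: "0 < cyclicity (E :: ('a::finite \<times> 'a) set)"
proof -
  let ?A = "{Gcd (circuit_lengths (E \<inter> C \<times> C)) | C.
    C \<in> access_classes E \<and> circuit_lengths (E \<inter> C \<times> C) \<noteq> {}}"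
  have "finite ?A"
    by (rule finite_subset[of _ "(\<lambda>C. Gcd (circuit_lengths (E \<inter> C \<times> C))) ` UNIV"]) auto
  moreover have "0 \<notin> ?A"
    by (auto simp: Gcd_0_iff) (auto simp: circuit_lengths_def)
  ultimately have "Lcm ?A \<noteq> 0"
    by (simp add: Lcm_0_iff)
  then show ?thesis
    unfolding cyclicity_def by (simp only: neq0_conv)
qed

lemma circuit_length_dvd_cyclicity:
  assumes "C \<in> access_classes E" "circuit_lengths (E \<inter> C \<times> C) \<noteq> {}"
  shows "Gcd (circuit_lengths (E \<inter> C \<times> C)) dvd cyclicity E"
  unfolding cyclicity_def using assms by (intro dvd_Lcm) auto

section \<open>Periods of the critical coordinates\<close>

context dominated_convex_map
begin

definition crit_digraph :: "('n \<times> 'n) set" where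
  "crit_digraph = (\<Union>P \<in> subdifferential F 0. critical_digraph P)"

definition crit_nodes :: "'n set" where
  "crit_nodes = (\<Union>P \<in> subdifferential F 0. critical_nodes P)"

text \<open>The factor comes from the Perron vector of the class and is the same for every recurrent
  point, so factors multiply along paths.\<close>

lemma crit_arc_scaling:
  assumes "(i, j) \<in> crit_digraph"
  shows "\<exists>a>0. \<forall>d y. recurrent_along d y \<longrightarrow> F y $ i = a * y $ j"
proof -
  obtain P where P: "P \<in> subdifferential F 0" "(i, j) \<in> critical_digraph P"
    using assms by (auto simp: crit_digraph_def)
  interpret stable_matrix P U
    by (rule subgradient_stable[OF P(1)])
  obtain K where K: "K \<in> critical_classes P" "i \<in> K" "j \<in> K" "0 < P $ i $ j"
    using P(2) by (auto simp: critical_digraph_iff)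
  obtain h where h: "\<And>i. i \<in> K \<Longrightarrow> 0 < h $ i" "truncation K *v h = h"
    using critical_class_eigenvectors[OF K(1)] by metis
  show ?thesis
    using recurrent_critical_arc[OF P(1) K(1) h _ K(2-4)] h(1)[OF K(2)] h(1)[OF K(3)]
    by (intro exI[of _ "h $ i / h $ j"]) auto
qed

lemma crit_path_scaling:
  assumes "(i, j) \<in> crit_digraph ^^ t"
  shows "\<exists>a>0. \<forall>d y. recurrent_along d y \<longrightarrow> (F ^^ t) y $ i = a * y $ j"
  using assms
proof (induction t arbitrary: j)
  case 0
  then show ?case
    by (auto intro: exI[of _ 1])
next
  case (Suc t)
  then obtain k where k: "(i, k) \<in> crit_digraph ^^ t" "(k, j) \<in> crit_digraph"
    by auto
  obtain a where a: "a > 0" "\<forall>d y. recurrent_along d y \<longrightarrow> (F ^^ t) y $ i = a * y $ k"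
    using Suc.IH[OF k(1)] by blast
  obtain b where b: "b > 0" "\<forall>d y. recurrent_along d y \<longrightarrow> F y $ k = b * y $ j"
    using crit_arc_scaling[OF k(2)] by blast
  have "(F ^^ Suc t) y $ i = a * b * y $ j" if "recurrent_along d y" for d y
    using that a(2)[rule_format, OF recurrent_step[OF that]] b(2)[rule_format, OF that]
    by (simp add: funpow_swap1)
  then show ?case
    using a(1) b(1) by (intro exI[of _ "a * b"]) simp
qed

text \<open>One turn multiplies coordinate i by a fixed a. The sum of its moduli over a turn changes
  by \<open>(a - 1) * \<bar>x $ i\<bar>\<close> at each step, of constant sign, and so is constant
  on recurrent orbits: \<open>a = 1\<close> or the coordinate is 0.\<close>

lemma crit_circuit_period:
  assumes "(i, i) \<in> crit_digraph ^^ t" and rec: "recurrent_along d y"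
  shows "(F ^^ t) y $ i = y $ i"
proof -
  obtain a where a: "a > 0" and "\<forall>d y. recurrent_along d y \<longrightarrow> (F ^^ t) y $ i = a * y $ i"
    using crit_path_scaling[OF assms(1)] by blast
  then have scale: "(F ^^ t) x $ i = a * x $ i" if "recurrent_along d x" for x
    using that by blast
  define \<phi> where "\<phi> x = (\<Sum>s<t. \<bar>(F ^^ s) x $ i\<bar>)" for x
  have diff: "\<phi> (F x) = \<phi> x + (a - 1) * \<bar>x $ i\<bar>" if "recurrent_along d x" for x
  proof -
    have "\<phi> (F x) = (\<Sum>s<t. \<bar>(F ^^ Suc s) x $ i\<bar>)"
      by (simp add: \<phi>_def funpow_swap1)
    also have "\<dots> = \<phi> x + (\<bar>(F ^^ t) x $ i\<bar> - \<bar>(F ^^ 0) x $ i\<bar>)"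
      unfolding sum_lessThan_telescope[of "\<lambda>s. \<bar>(F ^^ s) x $ i\<bar>" t, symmetric]
      by (simp add: \<phi>_def sum_subtractf)
    finally show ?thesis
      using a scale[OF that] by (simp add: abs_mult algebra_simps)
  qed
  have cont: "continuous_on UNIV \<phi>"
    unfolding \<phi>_def using F_iterate_continuous by (intro continuous_intros) auto
  have "\<phi> (F y) = \<phi> y"
  proof (cases "a \<ge> 1")
    case True
    then show ?thesis
      by (intro recurrent_mono_const[OF rec cont]) (simp add: diff)
  next
    case False
    then show ?thesis
      by (intro recurrent_anti_const[OF rec cont]) (simp add: diff mult_nonpos_nonneg)
  qed
  then show ?thesis
    using diff[OF rec] scale[OF rec] by auto
qed

text \<open>Coordinate i after s steps is a multiple of coordinate j, so a period at j is inherited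
  by i at points of the form \<open>(F ^^ s) w\<close>; the circuit at i makes y agree with such a
  point at i.\<close>

lemma crit_period_transport:
  assumes path: "(i, j) \<in> crit_digraph\<^sup>*" and circ: "(j, j) \<in> crit_digraph ^^ t"
    and self: "(i, i) \<in> crit_digraph ^^ u" "0 < u" and rec: "recurrent_along d y"
  shows "(F ^^ t) y $ i = y $ i"
proof -
  obtain s where s: "(i, j) \<in> crit_digraph ^^ s"
    using path rtrancl_power by blast
  obtain a where "\<forall>d y. recurrent_along d y \<longrightarrow> (F ^^ s) y $ i = a * y $ j"
    using crit_path_scaling[OF s] by blast
  then have a: "(F ^^ s) x $ i = a * x $ j" if "recurrent_along d x" for x
    using that by blast
  have multiple: "(F ^^ (s * u)) z $ i = z $ i" if "recurrent_along d z" for z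
  proof (induction s)
    case (Suc s)
    have "(F ^^ (Suc s * u)) z = (F ^^ u) ((F ^^ (s * u)) z)"
      by (simp add: funpow_add)
    then show ?case
      using crit_circuit_period[OF self(1) recurrent_iterate[OF that]] Suc by simp
  qed simp
  \<comment> \<open>Chosen so that s more steps lead to time \<open>s * u\<close>, a multiple of the
    period u of coordinate i; \<open>0 < u\<close> ensures that the difference is not
    truncated.\<close>
  define w where "w = (F ^^ (s * u - s)) y"
  have w: "recurrent_along d w"
    unfolding w_def by (rule recurrent_iterate[OF rec])
  have "s \<le> s * u"
    using self(2) by simp
  then have Fw: "(F ^^ s) w = (F ^^ (s * u)) y"
    unfolding w_def by (metis add_diff_inverse_nat comp_apply funpow_add leD)
  have "(F ^^ t) y $ i = (F ^^ (s * u)) ((F ^^ t) y) $ i"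
    using multiple[OF recurrent_iterate[OF rec]] by simp
  also have "(F ^^ (s * u)) ((F ^^ t) y) = (F ^^ t) ((F ^^ (s * u)) y)"
    by (metis add.commute comp_apply funpow_add)
  also have "\<dots> = (F ^^ s) ((F ^^ t) w)"
    unfolding Fw[symmetric] by (metis add.commute comp_apply funpow_add)
  also have "\<dots> $ i = a * (F ^^ t) w $ j"
    by (rule a[OF recurrent_iterate[OF w]])
  also have "\<dots> = (F ^^ s) w $ i"
    using crit_circuit_period[OF circ w] a[OF w] by simp
  also have "\<dots> = y $ i"
    unfolding Fw by (rule multiple[OF rec])
  finally show ?thesis .
qed

lemma crit_node_successor:
  assumes "i \<in> crit_nodes"
  shows "\<exists>j. (i, j) \<in> crit_digraph \<and> (j, i) \<in> crit_digraph\<^sup>*"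
proof -
  obtain P K where P: "P \<in> subdifferential F 0" and K: "K \<in> critical_classes P" "i \<in> K"
    using assms by (auto simp: crit_nodes_def critical_nodes_def)
  interpret stable_matrix P U
    by (rule subgradient_stable[OF P])
  obtain j where j: "j \<in> K" "0 < P $ i $ j"
    using critical_class_successor[OF K] by blast
  have "digraph_of_matrix P \<inter> K \<times> K \<subseteq> critical_digraph P"
    using K(1) by (auto simp: critical_digraph_iff digraph_of_matrix_def)
  also have "\<dots> \<subseteq> crit_digraph"
    using P by (auto simp: crit_digraph_def)
  finally have sub: "digraph_of_matrix P \<inter> K \<times> K \<subseteq> crit_digraph" .
  have "(j, i) \<in> (digraph_of_matrix P \<inter> K \<times> K)\<^sup>*"
    by (rule access_class_path[OF critical_class_access[OF K(1)] j(1) K(2)])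
  then have "(j, i) \<in> crit_digraph\<^sup>*"
    by (rule subsetD[OF rtrancl_mono[OF sub]])
  moreover have "(i, j) \<in> crit_digraph"
    using sub j K(2) by (auto simp: digraph_of_matrix_def)
  ultimately show ?thesis
    by blast
qed

lemma crit_node_periodic:
  assumes i: "i \<in> crit_nodes" and rec: "recurrent_along d y"
  shows "(F ^^ cyclicity crit_digraph) y $ i = y $ i"
proof -
  let ?E = crit_digraph
  obtain C where C: "C \<in> access_classes ?E" "i \<in> C"
    using access_class_exists[of ?E i] by blast
  obtain j where j: "(i, j) \<in> ?E" "(j, i) \<in> ?E\<^sup>*"
    using crit_node_successor[OF i] by blast
  then have "j \<in> C"
    using access_class_iff[OF C, of j] by blast
  then have "(i, j) \<in> ?E \<inter> C \<times> C" "(j, i) \<in> (?E \<inter> C \<times> C)\<^sup>*"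
    using j(1) C(2) access_class_path[OF C(1) _ C(2), of j] by auto
  then have "(i, i) \<in> (?E \<inter> C \<times> C)\<^sup>+"
    by (rule rtrancl_into_trancl2)
  then obtain u where u: "(i, i) \<in> (?E \<inter> C \<times> C) ^^ u" "0 < u"
    by (auto simp: trancl_power)
  \<comment> \<open>Common periods of coordinate i at all points recurrent along d. Quantifying over
    the points gives closure under sums and cancellation, because iterates are again recurrent along
    d.\<close>
  define S where "S = {t. \<forall>y. recurrent_along d y \<longrightarrow> (F ^^ t) y $ i = y $ i}"
  have up: "(k, l) \<in> (?E \<inter> C \<times> C) ^^ t \<Longrightarrow> (k, l) \<in> ?E ^^ t" for k l t
    by (induction t arbitrary: l) auto
  have "circuit_lengths (?E \<inter> C \<times> C) \<subseteq> S"
  proof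
    fix t assume "t \<in> circuit_lengths (?E \<inter> C \<times> C)"
    then obtain k where k: "0 < t" "(k, k) \<in> (?E \<inter> C \<times> C) ^^ t"
      by (auto simp: circuit_lengths_def)
    then have "k \<in> C"
      by (cases t) auto
    then have "(i, k) \<in> ?E\<^sup>*"
      using access_class_iff[OF C, of k] by blast
    then show "t \<in> S"
      unfolding S_def using crit_period_transport[OF _ up[OF k(2)] up[OF u(1)] u(2)] by blast
  qed
  then have "Gcd (circuit_lengths (?E \<inter> C \<times> C)) \<in> S"
  proof (rule Gcd_mem_numerical[rotated -1])
    show "s + t \<in> S" if "s \<in> S" "t \<in> S" for s t
      using that recurrent_iterate by (auto simp: S_def funpow_add)
    show "t \<in> S" if "s \<in> S" "s + t \<in> S" for s t
      using that recurrent_iterate by (auto simp: S_def funpow_add)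
  qed (simp add: S_def)
  moreover have "q * s \<in> S" if "s \<in> S" for q s
    using that recurrent_iterate by (induction q) (auto simp: S_def funpow_add)
  \<comment> \<open>This puts the component of i among those that \<open>cyclicity\<close> takes
    into account.\<close>
  moreover have "circuit_lengths (?E \<inter> C \<times> C) \<noteq> {}"
    using u by (auto simp: circuit_lengths_def)
  then obtain q where "cyclicity ?E = Gcd (circuit_lengths (?E \<inter> C \<times> C)) * q"
    using circuit_length_dvd_cyclicity[OF C(1)] by (auto elim: dvdE)
  then have "cyclicity ?E = q * Gcd (circuit_lengths (?E \<inter> C \<times> C))"
    by (simp only: mult.commute)
  ultimately have "cyclicity ?E \<in> S"
    by simp
  then show ?thesis
    using rec by (simp add: S_def)
qed

end

section \<open>Recurrent points off the critical nodes\<close>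

definition proj_on :: "'n set \<Rightarrow> real ^ 'n \<Rightarrow> real ^ 'n" where
  "proj_on S x = (\<chi> i. if i \<in> S then x $ i else 0)"

lemma proj_on_nth [simp]: "proj_on S x $ i = (if i \<in> S then x $ i else 0)"
  by (simp add: proj_on_def)

lemma proj_on_split: "proj_on (- S) x + proj_on S x = x"
  by (simp add: cart_eq_iff)

lemma proj_on_inner: "proj_on S x \<bullet> y = x \<bullet> proj_on S y"
  unfolding inner_vec_def by (rule sum.cong) auto

lemma vector_matrix_nonneg:
  fixes A :: "real ^ 'm ^ 'n"
  assumes "\<And>i j. 0 \<le> A $ i $ j" "\<And>i. 0 \<le> x $ i"
  shows "0 \<le> (x v* A) $ j"
  using assms by (auto simp: vector_matrix_mult_def intro!: sum_nonneg)

text \<open>Mass starting at \<open>i\<close> is transported by the matrices \<open>R s\<close>; what enters \<open>N\<close> leaks out.\<close>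

primrec surviving :: "'n set \<Rightarrow> 'n \<Rightarrow> (nat \<Rightarrow> real ^ 'n ^ 'n) \<Rightarrow> nat \<Rightarrow> real ^ 'n" where
  "surviving N i R 0 = axis i 1"
| "surviving N i R (Suc s) = proj_on (- N) (surviving N i R s v* R s)"

definition leak :: "'n set \<Rightarrow> 'n \<Rightarrow> (nat \<Rightarrow> real ^ 'n ^ 'n) \<Rightarrow> nat \<Rightarrow> real ^ 'n" where
  "leak N i R s = proj_on N (surviving N i R s v* R s)"

lemma surviving_step: "surviving N i R s v* R s = surviving N i R (Suc s) + leak N i R s"
  by (simp add: leak_def proj_on_split)

lemma surviving_nonneg:
  assumes "\<And>s i j. 0 \<le> R s $ i $ j"
  shows "0 \<le> surviving N i R s $ j"
  using assms by (induction s arbitrary: j) (auto simp: axis_def intro: vector_matrix_nonneg)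

lemma leak_nonneg:
  assumes "\<And>s i j. 0 \<le> R s $ i $ j"
  shows "0 \<le> leak N i R s $ j"
  using surviving_nonneg[OF assms] assms by (auto simp: leak_def intro: vector_matrix_nonneg)

lemma surviving_outside: "i \<notin> N \<Longrightarrow> j \<in> N \<Longrightarrow> surviving N i R s $ j = 0"
  by (cases s) (auto simp: axis_def)

lemma finite_max_attained:
  fixes g :: "'a \<Rightarrow> 'b::linorder"
  assumes "finite N" "N \<noteq> {}"
  shows "\<exists>k\<in>N. \<forall>i\<in>N. g i \<le> g k"
proof -
  have "Max (g ` N) \<in> g ` N"
    using assms by (intro Max_in) auto
  then obtain k where "k \<in> N" "g k = Max (g ` N)"
    by auto
  then show ?thesis
    using assms by (auto intro!: bexI[of _ k])
qed

context dominated_convex_map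
begin

text \<open>A single h has to serve along a whole orbit although the subgradients change. At a
  critical node F agrees at recurrent points with a row of a subgradient at 0, so this row is also
  admissible at y; the other rows may come from any subgradient at y, as h vanishes there. Transport
  by Q thus never decreases nonnegative mass weighed by h.\<close>

lemma crit_superharmonic:
  "\<exists>h\<ge>0. (\<forall>i. 0 < h $ i \<longleftrightarrow> i \<in> crit_nodes) \<and>
    (\<forall>d y. recurrent_along d y \<longrightarrow> (\<exists>Q \<in> subdifferential F y. h \<le> Q *v h))"
proof -
  have "\<exists>P K h. P \<in> subdifferential F 0 \<and> K \<in> critical_classes P \<and> i \<in> K \<and> 0 \<le> h \<and>
      (\<forall>k. 0 < h $ k \<longleftrightarrow> k \<in> K) \<and> h \<le> P *v h" if i: "i \<in> crit_nodes" for i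
  proof -
    obtain P K where P: "P \<in> subdifferential F 0" and K: "K \<in> critical_classes P" "i \<in> K"
      using i by (auto simp: crit_nodes_def critical_nodes_def)
    interpret stable_matrix P U
      by (rule subgradient_stable[OF P])
    obtain h where h: "0 \<le> h" "\<And>i. i \<in> K \<Longrightarrow> 0 < h $ i" "\<And>i. i \<notin> K \<Longrightarrow> h $ i = 0"
        "truncation K *v h = h"
      using critical_class_eigenvectors[OF K(1)] by metis
    have "h \<le> P *v h"
      using truncation_le[OF h(1), of K] by (simp add: h(4))
    moreover have "0 < h $ k \<longleftrightarrow> k \<in> K" for k
      using h(2)[of k] h(3)[of k] by force
    ultimately show ?thesis
      using P K h(1) by (intro exI[of _ P] exI[of _ K] exI[of _ h]) simp
  qed
  then have "\<forall>i\<in>crit_nodes. \<exists>t. fst t \<in> subdifferential F 0 \<and>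
      fst (snd t) \<in> critical_classes (fst t) \<and> i \<in> fst (snd t) \<and> 0 \<le> snd (snd t) \<and>
      (\<forall>k. 0 < snd (snd t) $ k \<longleftrightarrow> k \<in> fst (snd t)) \<and> snd (snd t) \<le> fst t *v snd (snd t)"
    by simp
  from bchoice[OF this] obtain t where t: "\<forall>i\<in>crit_nodes. fst (t i) \<in> subdifferential F 0 \<and>
      fst (snd (t i)) \<in> critical_classes (fst (t i)) \<and> i \<in> fst (snd (t i)) \<and> 0 \<le> snd (snd (t i)) \<and>
      (\<forall>k. 0 < snd (snd (t i)) $ k \<longleftrightarrow> k \<in> fst (snd (t i))) \<and>
      snd (snd (t i)) \<le> fst (t i) *v snd (snd (t i))"
    by blast
  define p where "p i = fst (t i)" for i
  define \<kappa> where "\<kappa> i = fst (snd (t i))" for i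
  define \<eta> where "\<eta> i = snd (snd (t i))" for i
  have p: "p i \<in> subdifferential F 0"
    and \<kappa>: "\<kappa> i \<in> critical_classes (p i)" "i \<in> \<kappa> i"
    and \<eta>: "0 < \<eta> i $ k \<longleftrightarrow> k \<in> \<kappa> i" "\<eta> i \<le> p i *v \<eta> i"
    if "i \<in> crit_nodes" for i k
    using t that by (auto simp: p_def \<kappa>_def \<eta>_def)
  \<comment> \<open>Classes of different subgradients may overlap, which calls for a maximum: at j
    the vector that is largest there supplies both \<open>h $ j\<close> and row j of Q.\<close>
  have "\<exists>\<sigma>\<in>crit_nodes. \<forall>i\<in>crit_nodes. \<eta> i $ j \<le> \<eta> \<sigma> $ j" if "j \<in> crit_nodes" for j
    using finite_max_attained[of crit_nodes "\<lambda>i. \<eta> i $ j"] that by auto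
  then have "\<forall>j\<in>crit_nodes. \<exists>\<sigma>. \<sigma> \<in> crit_nodes \<and> (\<forall>i\<in>crit_nodes. \<eta> i $ j \<le> \<eta> \<sigma> $ j)"
    by blast
  from bchoice[OF this] obtain \<sigma> where
      "\<forall>j\<in>crit_nodes. \<sigma> j \<in> crit_nodes \<and> (\<forall>i\<in>crit_nodes. \<eta> i $ j \<le> \<eta> (\<sigma> j) $ j)"
    by blast
  then have \<sigma>: "\<sigma> j \<in> crit_nodes" "i \<in> crit_nodes \<Longrightarrow> \<eta> i $ j \<le> \<eta> (\<sigma> j) $ j"
    if "j \<in> crit_nodes" for i j
    using that by auto
  define h where "h = (\<chi> j. if j \<in> crit_nodes then \<eta> (\<sigma> j) $ j else 0)"
  have hpos: "0 < h $ j" if j: "j \<in> crit_nodes" for j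
    using \<eta>(1)[OF j, of j] \<kappa>(2)[OF j] \<sigma>(2)[OF j j] j by (simp add: h_def)
  have h0: "0 \<le> h"
    unfolding vec_le_iff
  proof
    show "0 $ i \<le> h $ i" for i
      using hpos[of i] by (cases "i \<in> crit_nodes") (auto simp: h_def)
  qed
  have \<eta>_le: "\<eta> i \<le> h" if i: "i \<in> crit_nodes" for i
    unfolding vec_le_iff
  proof
    fix j
    show "\<eta> i $ j \<le> h $ j"
    proof (cases "j \<in> crit_nodes")
      case True
      then show ?thesis
        using \<sigma>(2)[OF True i] by (simp add: h_def)
    next
      case False
      then have "j \<notin> \<kappa> i"
        using \<kappa>(1)[OF i] p[OF i] by (auto simp: crit_nodes_def critical_nodes_def)
      then show ?thesis
        using \<eta>(1)[OF i, of j] False by (simp add: h_def)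
    qed
  qed
  show ?thesis
  proof (intro exI[of _ h] conjI allI impI)
    show "0 \<le> h"
      by (rule h0)
    show "0 < h $ i \<longleftrightarrow> i \<in> crit_nodes" for i
      using hpos[of i] by (auto simp: h_def)
    fix d y assume rec: "recurrent_along d y"
    obtain Q0 where Q0: "Q0 \<in> subdifferential F y"
      using subdifferential_nonempty by blast
    define Q where "Q = (\<chi> j. if j \<in> crit_nodes then p (\<sigma> j) $ j else Q0 $ j)"
    have row: "(Q *v x) $ j = (if j \<in> crit_nodes then (p (\<sigma> j) *v x) $ j else (Q0 *v x) $ j)" for x j
      by (simp add: Q_def matrix_vector_mult_def)
    have \<sigma>_class: "j \<in> \<kappa> (\<sigma> j)" if j: "j \<in> crit_nodes" for j
      using hpos[OF j] \<eta>(1)[OF \<sigma>(1)[OF j], of j] j by (simp add: h_def)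
    have "(Q *v (x - y)) $ j \<le> (F x - F y) $ j" for x j
    proof (cases "j \<in> crit_nodes")
      case True
      have "F y $ j = (p (\<sigma> j) *v y) $ j"
        using recurrent_critical_row(1)[OF p[OF \<sigma>(1)[OF True]] \<kappa>(1)[OF \<sigma>(1)[OF True]] rec \<sigma>_class[OF True]] .
      moreover have "(p (\<sigma> j) *v x) $ j \<le> F x $ j"
        using subgradient_0_le[OF p[OF \<sigma>(1)[OF True]], of x] by (simp add: vec_le_iff)
      ultimately show ?thesis
        using True by (simp add: row matrix_vector_mult_diff_distrib)
    next
      case False
      then show ?thesis
        using subgradientD[OF Q0, of x] by (simp add: row vec_le_iff)
    qed
    then have Q: "Q \<in> subdifferential F y"
      by (simp add: subdifferential_def vec_le_iff)
    have "h $ j \<le> (Q *v h) $ j" for j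
    proof (cases "j \<in> crit_nodes")
      case True
      let ?k = "\<sigma> j"
      note k = \<sigma>(1)[OF True]
      have "h $ j = \<eta> ?k $ j"
        using True by (simp add: h_def)
      also have "\<dots> \<le> (p ?k *v \<eta> ?k) $ j"
        using \<eta>(2)[OF k] by (simp add: vec_le_iff)
      also have "\<dots> \<le> (p ?k *v h) $ j"
        using matrix_vector_mono[OF subgradient_nonneg[OF p[OF k]] \<eta>_le[OF k]] by (simp add: vec_le_iff)
      finally show ?thesis
        using True by (simp add: row)
    next
      case False
      have "0 \<le> (Q *v h) $ j"
        using matrix_vector_mono[OF subgradient_nonneg[OF Q] h0] by (simp add: vec_le_iff)
      with False show ?thesis
        by (simp add: h_def)
    qed
    then have "h \<le> Q *v h"
      by (simp add: vec_le_iff)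
    with Q show "\<exists>Q \<in> subdifferential F y. h \<le> Q *v h"
      by blast
  qed
qed

text \<open>Leaked mass is not lost when weighed by h: because \<open>h \<le> R s *v h\<close>, it
  would at least keep its weight if it were transported further. So surviving and leaked mass
  together are dominated by one orbit of G, whatever the number of steps.\<close>

lemma surviving_leak_bound:
  assumes R: "\<And>s i j. 0 \<le> R s $ i $ j" "\<And>s x. R s *v x \<le> G x"
    and h: "0 \<le> h" "\<And>i. i \<notin> N \<Longrightarrow> h $ i = 0" "\<And>s. h \<le> R s *v h" and i: "i \<notin> N" and x: "0 \<le> x"
  shows "surviving N i R s \<bullet> x + (\<Sum>l<s. leak N i R l) \<bullet> h \<le> (G ^^ s) (proj_on (- N) x + h) $ i"
    (is "?L s x \<le> _")
  using x
proof (induction s arbitrary: x)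
  case 0
  have "0 \<le> h $ i"
    using h(1) by (simp add: vec_le_iff)
  then show ?case
    using i by (simp add: inner_axis')
next
  case (Suc s)
  let ?x = "proj_on (- N) x + h"
  have x': "0 \<le> ?x"
    using Suc.prems h(1) by (auto simp: vec_le_iff)
  have Rx': "0 \<le> R s *v ?x"
    using matrix_vector_mono[OF R(1) x', of s] by simp
  have "?L (Suc s) x = (surviving N i R s v* R s) \<bullet> ?x + (\<Sum>l<s. leak N i R l) \<bullet> h"
  proof -
    have "leak N i R s \<bullet> proj_on (- N) x = 0"
      by (auto simp: leak_def inner_vec_def intro!: sum.neutral)
    moreover have "surviving N i R (Suc s) \<bullet> h = 0"
      using h(2) by (auto simp: inner_vec_def intro!: sum.neutral)
    moreover have "surviving N i R (Suc s) \<bullet> proj_on (- N) x = surviving N i R (Suc s) \<bullet> x"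
      by (simp add: proj_on_inner[symmetric]) (simp add: inner_vec_def cong: if_cong)
    ultimately show ?thesis
      unfolding surviving_step by (simp add: inner_add_left inner_add_right)
  qed
  also have "\<dots> = ?L s (R s *v ?x)"
    by (simp add: dot_lmul_matrix)
  also have "\<dots> \<le> (G ^^ s) (proj_on (- N) (R s *v ?x) + h) $ i"
    by (rule Suc.IH[OF Rx'])
  \<comment> \<open>On N only h is left, and it lies below \<open>R s *v ?x\<close>; off N it
    vanishes.\<close>
  also have "proj_on (- N) (R s *v ?x) + h \<le> G ?x"
  proof -
    have "h \<le> ?x"
      using Suc.prems by (auto simp: vec_le_iff)
    then have "R s *v h \<le> R s *v ?x"
      by (rule matrix_vector_mono[OF R(1)])
    then have "h \<le> R s *v ?x"
      using h(3) order_trans by blast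
    then have "proj_on (- N) (R s *v ?x) + h \<le> R s *v ?x"
      using h(2) by (auto simp: vec_le_iff)
    also have "\<dots> \<le> G ?x"
      by (rule R(2))
    finally show ?thesis .
  qed
  then have "(G ^^ s) (proj_on (- N) (R s *v ?x) + h) $ i \<le> (G ^^ Suc s) ?x $ i"
    using G_iterate_mono[of _ "G ?x" s] by (simp add: vec_le_iff funpow_swap1)
  finally show ?case .
qed

end

lemma nth_le_inner_1:
  fixes m :: "real ^ 'n"
  assumes "\<And>j. 0 \<le> m $ j"
  shows "m $ j \<le> m \<bullet> 1"
  unfolding inner_vec_def using member_le_sum[of j UNIV "\<lambda>j. m $ j"] assms by simp

lemma inner_le_1:
  fixes m x :: "real ^ 'n"
  assumes "\<And>j. 0 \<le> m $ j" "\<And>j. x $ j \<le> c"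
  shows "m \<bullet> x \<le> c * (m \<bullet> 1)"
  using inner_mono_vec[of m x "c *\<^sub>R 1"] assms by (simp add: vec_le_iff)

context dominated_convex_map
begin

lemma F_iterate_nth_le: "\<bar>(F ^^ k) x $ j\<bar> \<le> lip * norm x"
  using component_le_norm_cart[of "(F ^^ k) x" j] F_iterate_norm_le[of k x] by linarith

text \<open>Up to the horizon \<open>n\<close>, the surviving mass gives an occupation measure \<open>M\<close> and a flow \<open>A\<close>
  out of it. The leaked mass is bounded, since it persists on the critical nodes. Hence so is the
  accumulated slack in the subgradient inequalities at \<open>0\<close>.\<close>

lemma horizon_occupation:
  assumes rec: "recurrent_along d y" and i: "i \<notin> crit_nodes"
    and agree: "\<And>k j. j \<in> crit_nodes \<Longrightarrow> (F ^^ k) y $ j = (F ^^ k) z $ j"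
  shows "\<exists>B C W. 0 < W \<and>
    (\<forall>n. \<exists>M A. (\<forall>j. 0 \<le> M $ j \<and> M $ j \<le> real n * B) \<and> (\<forall>j\<in>crit_nodes. M $ j = 0) \<and>
      (\<forall>j l. \<bar>A $ j $ l\<bar> \<le> real n * B) \<and> (\<forall>x j. (A *v x) $ j \<le> M $ j * F x $ j + C) \<and>
      (\<forall>l. \<bar>(1 v* A) $ l - M $ l\<bar> \<le> C) \<and>
      real n * ((F ^^ n) y - (F ^^ n) z) $ i \<le> W * (M \<bullet> 1))"
proof -
  let ?N = crit_nodes
  obtain h where h: "0 \<le> h" "\<forall>i. 0 < h $ i \<longleftrightarrow> i \<in> ?N"
      "\<forall>d y. recurrent_along d y \<longrightarrow> (\<exists>Q \<in> subdifferential F y. h \<le> Q *v h)"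
    using crit_superharmonic by blast
  have hout: "h $ j = 0" if "j \<notin> ?N" for j
    using h(1) h(2)[rule_format, of j] that by (auto simp: vec_le_iff order_le_less)
  have "\<forall>k. \<exists>Q. Q \<in> subdifferential F ((F ^^ k) y) \<and> h \<le> Q *v h"
    using h(3) recurrent_iterate[OF rec] by blast
  from choice[OF this] obtain Q where
    Q: "\<And>k. Q k \<in> subdifferential F ((F ^^ k) y)" "\<And>k. h \<le> Q k *v h"
    by blast
  define Y where "Y k = (F ^^ k) y" for k
  \<comment> \<open>Positive part of the difference of the two orbits. It vanishes on the critical
    nodes, and its growth in one step is controlled by the subgradient chosen at
    \<open>(F ^^ k) y\<close>.\<close>
  define w where "w k = (\<chi> j. max 0 (((F ^^ k) y - (F ^^ k) z) $ j))" for k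
  \<comment> \<open>b bounds the surviving mass plus the leak weighed by h, Yb the orbit of y, Lb
    the total leak, Wb the positive parts. C collects the slack and the boundary terms of the
    telescoping sums, B bounds the entries per unit of time; none depends on the horizon.\<close>
  define b Yb where "b = norm (1 + h) * U $ i" and "Yb = lip * norm y"
  define Lb where "Lb = (\<Sum>j\<in>?N. b / h $ j)"
  define Wb where "Wb = lip * norm y + lip * norm z + 1"
  define C where "C = Yb * b + Yb + Yb * Lb + (b + 1 + Lb)"
  define B where "B = b * lip + b"
  have b0: "0 \<le> b" and Yb0: "0 \<le> Yb" and Wb: "0 < Wb"
    using U_pos[of i] lip_pos by (auto simp: b_def Yb_def Wb_def intro!: add_nonneg_pos)
  have Lb0: "0 \<le> Lb"
    unfolding Lb_def using b0 h(2) by (intro sum_nonneg divide_nonneg_pos) auto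
  have Qnn: "0 \<le> Q k $ i $ j" for k i j
    by (rule subgradient_nonneg[OF Q(1)])
  have QG: "Q k *v x \<le> G x" for k x
    by (rule subgradient_le_G[OF Q(1)])
  have Q_lip: "Q k $ j $ l \<le> lip" for k j l
  proof -
    have "Q k $ j $ l \<le> (\<Sum>l\<in>UNIV. Q k $ j $ l)"
      using Qnn by (intro member_le_sum) auto
    also have "\<dots> = (Q k *v 1) $ j"
      by (simp add: matrix_vector_mult_def)
    also have "\<dots> \<le> U $ j"
      using order_trans[OF QG[of k 1]] G_bounded[of 1] by (simp add: vec_le_iff)
    also have "\<dots> \<le> lip"
      unfolding lip_def using U_pos by (intro member_le_sum) (auto intro: less_imp_le)
    finally show ?thesis .
  qed
  have wout: "w k $ j = 0" if "j \<in> ?N" for k j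
    using agree[OF that] by (simp add: w_def)
  have w_step: "w (Suc k) \<le> Q k *v w k" for k
  proof -
    have "(F ^^ k) y - (F ^^ k) z \<le> w k" "0 \<le> w k"
      by (auto simp: w_def vec_le_iff)
    then have "Q k *v ((F ^^ k) y - (F ^^ k) z) \<le> Q k *v w k" "0 \<le> Q k *v w k"
      using matrix_vector_mono[OF Qnn] by (blast, metis matrix_vector_mult_0_right)
    moreover have "(F ^^ Suc k) y - (F ^^ Suc k) z \<le> Q k *v ((F ^^ k) y - (F ^^ k) z)"
      using subgradientD[OF Q(1), of k "(F ^^ k) z"]
      by (simp add: vec_le_iff matrix_vector_mult_diff_distrib algebra_simps)
    ultimately show ?thesis
      by (auto simp: w_def vec_le_iff intro: order_trans)
  qed
  have w_le: "w k $ j \<le> Wb" for k j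
    using F_iterate_nth_le[of k y j] F_iterate_nth_le[of k z j] Wb by (auto simp: w_def Wb_def)
  have main: "\<exists>M A. (\<forall>j. 0 \<le> M $ j \<and> M $ j \<le> real n * B) \<and> (\<forall>j\<in>?N. M $ j = 0) \<and>
      (\<forall>j l. \<bar>A $ j $ l\<bar> \<le> real n * B) \<and> (\<forall>x j. (A *v x) $ j \<le> M $ j * F x $ j + C) \<and>
      (\<forall>l. \<bar>(1 v* A) $ l - M $ l\<bar> \<le> C) \<and>
      real n * ((F ^^ n) y - (F ^^ n) z) $ i \<le> Wb * (M \<bullet> 1)" for n
  proof -
    \<comment> \<open>Time runs backwards: the mass starts at node i at time n, because unfolding
      \<open>w (Suc k) \<le> Q k *v w k\<close> from time n meets the latest subgradient
      first.\<close>
    define R where "R s = Q (n - Suc s)" for s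
    define \<nu> where "\<nu> = surviving ?N i R"
    define r where "r = leak ?N i R"
    define M where "M = (\<Sum>s<n. \<nu> s)"
    define A where "A = (\<chi> j l. \<Sum>s<n. \<nu> s $ j * R s $ j $ l)"
    have step: "\<nu> s v* R s = \<nu> (Suc s) + r s" for s
      unfolding \<nu>_def r_def by (rule surviving_step)
    have \<nu>0: "0 \<le> \<nu> s $ j" and r0: "0 \<le> r s $ j" for s j
      unfolding \<nu>_def r_def by (intro surviving_nonneg leak_nonneg; simp add: R_def Qnn)+
    have \<nu>out: "\<nu> s $ j = 0" if "j \<in> ?N" for s j
      unfolding \<nu>_def by (rule surviving_outside[OF i that])
    have rout: "r s $ j = 0" if "j \<notin> ?N" for s j
      using that by (simp add: r_def leak_def)
    have sum_bound: "\<nu> s \<bullet> 1 + (\<Sum>l<s. r l) \<bullet> h \<le> b" for s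
    proof -
      have "\<nu> s \<bullet> 1 + (\<Sum>l<s. r l) \<bullet> h \<le> (G ^^ s) (proj_on (- ?N) 1 + h) $ i"
        unfolding \<nu>_def r_def
      proof (rule surviving_leak_bound)
        show "0 \<le> (1 :: real ^ 'n)"
          by (simp add: vec_le_iff)
      qed (simp_all add: R_def Qnn QG h(1) hout Q(2) i)
      also have "(G ^^ s) (proj_on (- ?N) 1 + h) \<le> (G ^^ s) (1 + h)"
        by (rule G_iterate_mono) (simp add: vec_le_iff)
      then have "(G ^^ s) (proj_on (- ?N) 1 + h) $ i \<le> b"
        using G_iterate_le[of s "1 + h"] by (simp add: vec_le_iff b_def) (meson order_trans)
      finally show ?thesis .
    qed
    have leak_h: "0 \<le> (\<Sum>l<s. r l) \<bullet> h" for s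
      using r0 h(1) by (auto simp: inner_vec_def vec_le_iff intro!: sum_nonneg mult_nonneg_nonneg)
    have \<nu>1: "\<nu> s \<bullet> 1 \<le> b" for s
      using sum_bound[of s] leak_h[of s] by linarith
    have \<nu>b: "\<nu> s $ j \<le> b" for s j
      using nth_le_inner_1[of "\<nu> s" j] \<nu>0 \<nu>1[of s] by force
    have \<nu>1_0: "0 \<le> \<nu> s \<bullet> 1" for s
      using \<nu>0 by (auto simp: inner_vec_def intro!: sum_nonneg)
    define \<Lambda> where "\<Lambda> = (\<Sum>l<n. r l)"
    have \<Lambda>0: "0 \<le> \<Lambda> $ j" for j
      unfolding \<Lambda>_def using r0 by (simp add: sum_nonneg)
    have \<Lambda>h: "\<Lambda> \<bullet> h \<le> b"
      using sum_bound[of n] \<nu>1_0[of n] by (simp add: \<Lambda>_def)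
    have \<Lambda>1: "\<Lambda> \<bullet> 1 \<le> Lb"
    proof -
      have "\<Lambda> \<bullet> 1 = (\<Sum>j\<in>UNIV. \<Lambda> $ j)"
        by (simp add: inner_vec_def)
      also have "\<dots> = (\<Sum>j\<in>?N. \<Lambda> $ j)"
        by (rule sum.mono_neutral_right) (auto simp: \<Lambda>_def rout)
      also have "\<dots> \<le> Lb"
        unfolding Lb_def
      proof (rule sum_mono)
        fix j assume j: "j \<in> ?N"
        have "\<Lambda> $ j * h $ j \<le> \<Lambda> \<bullet> h"
          unfolding inner_vec_def inner_real_def using \<Lambda>0 h(1)
          by (intro member_le_sum[of j UNIV "\<lambda>j. \<Lambda> $ j * h $ j"]) (auto simp: vec_le_iff)
        then show "\<Lambda> $ j \<le> b / h $ j"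
          using \<Lambda>h h(2)[rule_format, of j] j by (simp add: field_simps)
      qed
      finally show ?thesis .
    qed
    \<comment> \<open>A subgradient at an orbit point satisfies the inequality at 0 up to an excess
      that does not depend on x; the choice \<open>x = 0\<close> below shows that this excess is
      nonnegative.\<close>
    have slack: "(R s *v x) $ j \<le> F x $ j + (R s *v Y (n - Suc s) - Y (n - s)) $ j"
      if "s < n" for s x j
    proof -
      have "(R s *v (x - Y (n - Suc s))) $ j \<le> (F x - F (Y (n - Suc s))) $ j"
        using subgradientD[OF Q(1), of "n - Suc s" x] by (simp add: R_def Y_def vec_le_iff)
      moreover have "F (Y (n - Suc s)) = Y (n - s)"
      proof -
        have "n - s = Suc (n - Suc s)"
          using that by simp
        then show ?thesis
          by (simp only: Y_def funpow.simps(2) o_apply)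
      qed
      ultimately show ?thesis
        by (simp add: matrix_vector_mult_diff_distrib)
    qed
    have slack0: "0 \<le> (R s *v Y (n - Suc s) - Y (n - s)) $ j" if "s < n" for s j
      using slack[OF that, of 0 j] by (simp add: F_0)
    \<comment> \<open>Transport by \<open>R s\<close> turns \<open>\<nu> s\<close> into
      \<open>\<nu> (Suc s)\<close> and a leak, so the sum telescopes to two boundary terms plus the
      leaked mass paired with the bounded orbit.\<close>
    have total: "(\<Sum>s<n. \<nu> s \<bullet> (R s *v Y (n - Suc s) - Y (n - s))) \<le> Yb * b + Yb + Yb * Lb"
    proof -
      have "\<nu> s \<bullet> (R s *v Y (n - Suc s) - Y (n - s)) =
          (\<nu> (Suc s) \<bullet> Y (n - Suc s) - \<nu> s \<bullet> Y (n - s)) + r s \<bullet> Y (n - Suc s)" for s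
        by (simp add: inner_diff_right inner_add_left step flip: dot_lmul_matrix)
      then have "(\<Sum>s<n. \<nu> s \<bullet> (R s *v Y (n - Suc s) - Y (n - s))) =
          (\<nu> n \<bullet> Y (n - n) - \<nu> 0 \<bullet> Y (n - 0)) + (\<Sum>s<n. r s \<bullet> Y (n - Suc s))"
        by (simp only: sum.distrib sum_lessThan_telescope[of "\<lambda>s. \<nu> s \<bullet> Y (n - s)"])
      moreover have "\<nu> n \<bullet> Y (n - n) \<le> Yb * (\<nu> n \<bullet> 1)"
        using \<nu>0 F_iterate_nth_le[of "n - n" y] by (intro inner_le_1) (auto simp: Yb_def Y_def abs_le_iff)
      moreover have "\<dots> \<le> Yb * b"
        by (rule mult_left_mono[OF \<nu>1 Yb0])
      moreover have "- (\<nu> 0 \<bullet> Y (n - 0)) \<le> Yb"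
        using F_iterate_nth_le[of n y i] by (simp add: \<nu>_def inner_axis' Y_def Yb_def abs_le_iff)
      moreover have "(\<Sum>s<n. r s \<bullet> Y (n - Suc s)) \<le> (\<Sum>s<n. Yb * (r s \<bullet> 1))"
        using r0 F_iterate_nth_le[of _ y]
        by (intro sum_mono inner_le_1) (auto simp: Yb_def Y_def abs_le_iff)
      moreover have "(\<Sum>s<n. Yb * (r s \<bullet> 1)) = Yb * (\<Lambda> \<bullet> 1)"
        by (simp add: \<Lambda>_def inner_sum_left sum_distrib_left)
      moreover have "\<dots> \<le> Yb * Lb"
        by (rule mult_left_mono[OF \<Lambda>1 Yb0])
      ultimately show ?thesis
        by linarith
    qed
    have M0: "0 \<le> M $ j" for j
      unfolding M_def using \<nu>0 by (simp add: sum_nonneg)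
    moreover have "M $ j \<le> real n * B" for j
    proof -
      have "(\<Sum>s<n. \<nu> s $ j) \<le> real n * b"
        using sum_bounded_above[of "{..<n}" "\<lambda>s. \<nu> s $ j" b] \<nu>b by simp
      also have "\<dots> \<le> real n * B"
        using b0 lip_pos by (intro mult_left_mono) (auto simp: B_def)
      finally show ?thesis
        by (simp add: M_def)
    qed
    moreover have "M $ j = 0" if "j \<in> ?N" for j
      using \<nu>out[OF that] by (simp add: M_def)
    moreover have "\<bar>A $ j $ l\<bar> \<le> real n * B" for j l
    proof -
      have "0 \<le> A $ j $ l"
        using \<nu>0 Qnn by (auto simp: A_def R_def intro!: sum_nonneg)
      moreover have "\<nu> s $ j * R s $ j $ l \<le> b * lip" for s
        using \<nu>b \<nu>0 Qnn Q_lip b0 by (simp add: R_def mult_mono)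
      then have "(\<Sum>s<n. \<nu> s $ j * R s $ j $ l) \<le> real n * (b * lip)"
        using sum_bounded_above[of "{..<n}" "\<lambda>s. \<nu> s $ j * R s $ j $ l" "b * lip"] by simp
      moreover have "\<dots> \<le> real n * B"
        using b0 by (intro mult_left_mono) (auto simp: B_def)
      ultimately show ?thesis
        by (simp add: A_def)
    qed
    moreover have "(A *v x) $ j \<le> M $ j * F x $ j + C" for x j
    proof -
      have "(A *v x) $ j = (\<Sum>s<n. \<nu> s $ j * (R s *v x) $ j)"
        unfolding A_def matrix_vector_mult_def
        by (simp add: sum_distrib_left sum_distrib_right mult.assoc) (rule sum.swap)
      also have "\<dots> \<le> (\<Sum>s<n. \<nu> s $ j * F x $ j + \<nu> s \<bullet> (R s *v Y (n - Suc s) - Y (n - s)))"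
      proof (rule sum_mono)
        fix s assume "s \<in> {..<n}"
        then have s: "s < n" by simp
        let ?d = "R s *v Y (n - Suc s) - Y (n - s)"
        have "\<nu> s $ j * (R s *v x) $ j \<le> \<nu> s $ j * (F x $ j + ?d $ j)"
          by (rule mult_left_mono[OF slack[OF s] \<nu>0])
        moreover have "\<nu> s $ j * ?d $ j \<le> \<nu> s \<bullet> ?d"
          unfolding inner_vec_def inner_real_def using \<nu>0 slack0[OF s]
          by (intro member_le_sum[of j UNIV "\<lambda>j. \<nu> s $ j * ?d $ j"]) auto
        ultimately show "\<nu> s $ j * (R s *v x) $ j \<le> \<nu> s $ j * F x $ j + \<nu> s \<bullet> ?d"
          by (simp add: distrib_left)
      qed
      also have "\<dots> = M $ j * F x $ j + (\<Sum>s<n. \<nu> s \<bullet> (R s *v Y (n - Suc s) - Y (n - s)))"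
        by (simp add: sum.distrib M_def sum_distrib_right)
      also have "\<dots> \<le> M $ j * F x $ j + C"
        using total b0 Lb0 by (simp add: C_def)
      finally show ?thesis .
    qed
    moreover have "\<bar>(1 v* A) $ l - M $ l\<bar> \<le> C" for l
    proof -
      have "(1 v* A) $ l = (\<Sum>s<n. (\<nu> s v* R s) $ l)"
        unfolding A_def vector_matrix_mult_def by simp (rule sum.swap)
      also have "\<dots> = (\<Sum>s<n. \<nu> (Suc s) $ l) + \<Lambda> $ l"
        by (simp add: step sum.distrib \<Lambda>_def)
      also have "(\<Sum>s<n. \<nu> (Suc s) $ l) = M $ l + (\<nu> n $ l - \<nu> 0 $ l)"
        unfolding sum_lessThan_telescope[of "\<lambda>s. \<nu> s $ l" n, symmetric] M_def
        by (simp add: sum_subtractf)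
      finally have "(1 v* A) $ l - M $ l = \<nu> n $ l - \<nu> 0 $ l + \<Lambda> $ l"
        by simp
      moreover have "\<nu> 0 $ l \<le> 1"
        by (simp add: \<nu>_def axis_def)
      moreover have "\<Lambda> $ l \<le> Lb"
        using nth_le_inner_1[of \<Lambda> l] \<Lambda>0 \<Lambda>1 by force
      moreover have "0 \<le> Yb * b" "0 \<le> Yb * Lb"
        using b0 Yb0 Lb0 by auto
      ultimately show ?thesis
        using \<nu>0[of n l] \<nu>0[of 0 l] \<nu>b[of n l] \<Lambda>0[of l] Yb0 b0 Lb0 unfolding C_def by linarith
    qed
    moreover have "real n * ((F ^^ n) y - (F ^^ n) z) $ i \<le> Wb * (M \<bullet> 1)"
    proof -
      \<comment> \<open>The leak sees nothing of w, which vanishes on the critical nodes, so the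
        surviving mass alone accounts for the difference at time n.\<close>
      have persist: "w n $ i \<le> \<nu> s \<bullet> w (n - s)" if "s \<le> n" for s
        using that
      proof (induction s)
        case 0
        then show ?case
          by (simp add: \<nu>_def inner_axis')
      next
        case (Suc s)
        have "r s \<bullet> w (n - Suc s) = 0"
          unfolding inner_vec_def
        proof (rule sum.neutral, rule ballI)
          show "r s $ j \<bullet> w (n - Suc s) $ j = 0" for j
            using rout[of j s] wout[of j] by (cases "j \<in> ?N") auto
        qed
        moreover have "\<nu> s \<bullet> w (n - s) \<le> \<nu> s \<bullet> (R s *v w (n - Suc s))"
          using w_step[of "n - Suc s"] Suc.prems \<nu>0 by (intro inner_mono_vec) (auto simp: R_def Suc_diff_Suc)
        ultimately show ?case
          using Suc by (simp add: inner_add_left step flip: dot_lmul_matrix)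
      qed
      have "w n $ i \<le> Wb * (\<nu> s \<bullet> 1)" if "s < n" for s
        using persist[of s] that inner_le_1[of "\<nu> s" "w (n - s)" Wb] \<nu>0 w_le by fastforce
      then have "(\<Sum>s<n. w n $ i) \<le> (\<Sum>s<n. Wb * (\<nu> s \<bullet> 1))"
        by (intro sum_mono) auto
      then have "real n * w n $ i \<le> Wb * (M \<bullet> 1)"
        by (simp add: M_def inner_sum_left sum_distrib_left)
      moreover have "real n * ((F ^^ n) y - (F ^^ n) z) $ i \<le> real n * w n $ i"
        by (intro mult_left_mono) (auto simp: w_def)
      ultimately show ?thesis
        by linarith
    qed
    ultimately show ?thesis
      by (intro exI[of _ M] exI[of _ A]) blast
  qed
  show ?thesis
    using Wb main by (intro exI[of _ B] exI[of _ C] exI[of _ Wb]) (rule conjI, assumption, rule allI)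
qed

end

section \<open>Limits of the normalised occupation measures\<close>

lemma norm_matrix_le_sum: "norm (A :: real ^ 'n ^ 'm) \<le> (\<Sum>j\<in>UNIV. \<Sum>l\<in>UNIV. \<bar>A $ j $ l\<bar>)"
proof -
  have "norm A \<le> (\<Sum>j\<in>UNIV. norm (A $ j))"
    unfolding norm_vec_def by (rule L2_set_le_sum) simp
  also have "\<dots> \<le> (\<Sum>j\<in>UNIV. \<Sum>l\<in>UNIV. \<bar>A $ j $ l\<bar>)"
    by (intro sum_mono norm_le_l1_cart)
  finally show ?thesis .
qed

context dominated_convex_map
begin

text \<open>The rows of \<open>A\<close>, normalised by \<open>M\<close>, are subgradients at \<open>0\<close> for which \<open>M\<close> is invariant.\<close>

lemma no_occupation_outside_crit_nodes:
  assumes M: "0 \<le> M" "\<And>j. j \<in> crit_nodes \<Longrightarrow> M $ j = 0"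
    and A: "\<And>x j. (A *v x) $ j \<le> M $ j * F x $ j" "1 v* A = M"
  shows "M = 0"
proof (rule ccontr)
  assume "M \<noteq> 0"
  obtain P0 where P0: "P0 \<in> subdifferential F 0"
    using subdifferential_nonempty by blast
  define P where "P = (\<chi> j. if 0 < M $ j then A $ j /\<^sub>R M $ j else P0 $ j)"
  have row: "(P *v x) $ j = (if 0 < M $ j then (A *v x) $ j / M $ j else (P0 *v x) $ j)" for x j
    by (simp add: P_def matrix_vector_mult_def sum_distrib_left divide_inverse ac_simps)
  have "(P *v x) $ j \<le> F x $ j" for x j
  proof (cases "0 < M $ j")
    case True
    then show ?thesis
      using A(1)[of x j] by (simp add: row divide_le_eq mult.commute)
  next
    case False
    then show ?thesis
      using subgradient_0_le[OF P0, of x] by (simp add: row vec_le_iff)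
  qed
  then have P: "P \<in> subdifferential F 0"
    by (simp add: subdifferential_def vec_le_iff F_0)
  have "M $ j * P $ j $ l = A $ j $ l" for j l
  proof (cases "0 < M $ j")
    case False
    then have "M $ j = 0"
      using M(1) by (auto simp: vec_le_iff order_le_less)
    \<comment> \<open>Where M vanishes, testing with both signs of the unit vector shows that the
      row of A vanishes as well, so filling in a row of \<open>P0\<close> is harmless.\<close>
    then have "A $ j $ l \<le> 0" "- (A $ j $ l) \<le> 0"
      using A(1)[of "axis l 1" j] A(1)[of "axis l (- 1)" j]
      by (simp_all add: matrix_vector_mult_def axis_def if_distrib[of "\<lambda>x. _ * x"] cong: if_cong)
    with \<open>M $ j = 0\<close> show ?thesis
      by simp
  qed (simp add: P_def)
  then have "M v* P = M"
    using A(2) by (simp add: vector_matrix_mult_def)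
  interpret stable_matrix P U
    by (rule subgradient_stable[OF P])
  obtain K i where "K \<in> critical_classes P" "i \<in> K" "M $ i \<noteq> 0"
    using left_eigenvector_critical_class[OF M(1) \<open>M \<noteq> 0\<close> \<open>M v* P = M\<close>] by blast
  then show False
    using P M(2)[of i] by (auto simp: crit_nodes_def critical_nodes_def)
qed

text \<open>Horizons are taken along the common return times, where the difference of the orbits is
  close to \<open>y - z\<close> again, so the mean surviving mass has a positive lower bound. The
  error C is divided by the horizon and vanishes, and the limit would be an occupation measure that
  cannot exist.\<close>

lemma recurrent_le:
  assumes rec: "recurrent_along d y" "recurrent_along d z"
    and agree: "\<And>k j. j \<in> crit_nodes \<Longrightarrow> (F ^^ k) y $ j = (F ^^ k) z $ j"
  shows "y \<le> z"
proof (rule ccontr)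
  assume "\<not> y \<le> z"
  then obtain i where i: "z $ i < y $ i"
    by (auto simp: vec_le_iff not_le)
  have "i \<notin> crit_nodes"
    using agree[of i 0] i by auto
  define \<delta> where "\<delta> = (y $ i - z $ i) / 2"
  have \<delta>: "0 < \<delta>"
    using i by (simp add: \<delta>_def)
  obtain B C W where W: "0 < W" and
    ex: "\<forall>n. \<exists>M A. (\<forall>j. 0 \<le> M $ j \<and> M $ j \<le> real n * B) \<and> (\<forall>j\<in>crit_nodes. M $ j = 0) \<and>
      (\<forall>j l. \<bar>A $ j $ l\<bar> \<le> real n * B) \<and> (\<forall>x j. (A *v x) $ j \<le> M $ j * F x $ j + C) \<and>
      (\<forall>l. \<bar>(1 v* A) $ l - M $ l\<bar> \<le> C) \<and>
      real n * ((F ^^ n) y - (F ^^ n) z) $ i \<le> W * (M \<bullet> 1)"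
    using horizon_occupation[OF rec(1) \<open>i \<notin> crit_nodes\<close> agree] by blast
  from choice[OF ex] obtain m where "\<forall>n. \<exists>A. (\<forall>j. 0 \<le> m n $ j \<and> m n $ j \<le> real n * B) \<and>
      (\<forall>j\<in>crit_nodes. m n $ j = 0) \<and> (\<forall>j l. \<bar>A $ j $ l\<bar> \<le> real n * B) \<and>
      (\<forall>x j. (A *v x) $ j \<le> m n $ j * F x $ j + C) \<and> (\<forall>l. \<bar>(1 v* A) $ l - m n $ l\<bar> \<le> C) \<and>
      real n * ((F ^^ n) y - (F ^^ n) z) $ i \<le> W * (m n \<bullet> 1)" ..
  from choice[OF this] obtain a where a: "\<forall>n. (\<forall>j. 0 \<le> m n $ j \<and> m n $ j \<le> real n * B) \<and>
      (\<forall>j\<in>crit_nodes. m n $ j = 0) \<and> (\<forall>j l. \<bar>a n $ j $ l\<bar> \<le> real n * B) \<and>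
      (\<forall>x j. (a n *v x) $ j \<le> m n $ j * F x $ j + C) \<and>
      (\<forall>l. \<bar>(1 v* a n) $ l - m n $ l\<bar> \<le> C) \<and>
      real n * ((F ^^ n) y - (F ^^ n) z) $ i \<le> W * (m n \<bullet> 1)" ..
  have t: "0 \<le> m n $ j" "m n $ j \<le> real n * B" "j \<in> crit_nodes \<Longrightarrow> m n $ j = 0"
      "\<bar>a n $ j $ l\<bar> \<le> real n * B" "(a n *v x) $ j \<le> m n $ j * F x $ j + C"
      "\<bar>(1 v* a n) $ l - m n $ l\<bar> \<le> C"
      "real n * ((F ^^ n) y - (F ^^ n) z) $ i \<le> W * (m n \<bullet> 1)" for n j l x
    using a[rule_format, of n] by blast+
  \<comment> \<open>At \<open>n = 0\<close> the quotient is 0 by the convention for division, so the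
    bound B holds for every n.\<close>
  define q where "q n = (m n /\<^sub>R real n, a n /\<^sub>R real n)" for n
  have q_bounded: "\<bar>fst (q n) $ j\<bar> \<le> B" "\<bar>snd (q n) $ j $ l\<bar> \<le> B" for n j l
  proof -
    have "0 \<le> B"
      using t(1)[of 1 i] t(2)[of 1 i] by simp
    then show "\<bar>fst (q n) $ j\<bar> \<le> B" "\<bar>snd (q n) $ j $ l\<bar> \<le> B"
      using t(1)[of n j] t(2)[of n j] t(4)[of n j l]
      by (cases "n = 0"; simp add: q_def field_simps abs_mult)+
  qed
  have "norm (q n) \<le> (\<Sum>j\<in>(UNIV :: 'n set). B) + (\<Sum>j\<in>(UNIV :: 'n set). \<Sum>l\<in>(UNIV :: 'n set). B)" for n
  proof -
    have "norm (fst (q n)) \<le> (\<Sum>j\<in>(UNIV :: 'n set). B)"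
      by (rule order_trans[OF norm_le_l1_cart]) (intro sum_mono q_bounded)
    moreover have "norm (snd (q n)) \<le> (\<Sum>j\<in>(UNIV :: 'n set). \<Sum>l\<in>(UNIV :: 'n set). B)"
      by (rule order_trans[OF norm_matrix_le_sum]) (intro sum_mono q_bounded)
    ultimately show ?thesis
      using norm_Pair_le[of "fst (q n)" "snd (q n)"] by simp
  qed
  \<comment> \<open>The convergent subsequence is chosen among the return times, not among all
    horizons.\<close>
  then have "bounded (range (\<lambda>k. q (d k)))"
    by (auto simp: bounded_iff)
  from bounded_imp_convergent_subsequence[OF this] obtain L r
    where r: "strict_mono r" and "((\<lambda>k. q (d k)) \<circ> r) \<longlonglongrightarrow> L"
    by blast
  then have L: "(\<lambda>k. q (d (r k))) \<longlonglongrightarrow> L"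
    by (simp add: o_def)
  define e where "e k = d (r k)" for k
  define M A where "M = fst L" and "A = snd L"
  have limM: "(\<lambda>k. fst (q (e k)) $ j) \<longlonglongrightarrow> M $ j" for j
    unfolding M_def e_def by (intro tendsto_vec_nth tendsto_fst L)
  have limA: "(\<lambda>k. snd (q (e k)) $ j $ l) \<longlonglongrightarrow> A $ j $ l" for j l
    unfolding A_def e_def by (intro tendsto_vec_nth tendsto_snd L)
  have e_top: "filterlim e at_top sequentially"
    unfolding e_def using rec(1)
    by (intro filterlim_compose[OF _ filterlim_subseq[OF r]]) (simp add: recurrent_along_def)
  then have "eventually (\<lambda>k. 1 \<le> e k) sequentially"
    by (auto simp: filterlim_at_top)
  then have e_pos: "eventually (\<lambda>k. 0 < e k) sequentially"
    by eventually_elim simp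
  have C_lim: "(\<lambda>k. C / real (e k)) \<longlonglongrightarrow> 0"
    using filterlim_compose[OF filterlim_real_sequentially e_top]
    by (intro tendsto_divide_0[OF tendsto_const] filterlim_at_top_imp_at_infinity)
  have "0 \<le> M $ j" for j
    using limM[of j] by (rule tendsto_lowerbound) (simp_all add: q_def t(1))
  then have M0: "0 \<le> M"
    by (simp add: vec_le_iff)
  have Mcrit: "M $ j = 0" if "j \<in> crit_nodes" for j
    using limM[of j] t(3)[OF that] by (simp add: q_def LIMSEQ_const_iff)
  have AF: "(A *v x) $ j \<le> M $ j * F x $ j" for x j
  proof -
    have 1: "(\<lambda>k. (snd (q (e k)) *v x) $ j) \<longlonglongrightarrow> (A *v x) $ j"
      unfolding matrix_vector_mult_def by (simp, intro tendsto_intros limA)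
    have 2: "(\<lambda>k. fst (q (e k)) $ j * F x $ j + C / real (e k)) \<longlonglongrightarrow> M $ j * F x $ j + 0"
      by (intro tendsto_intros limM C_lim)
    have 3: "eventually (\<lambda>k. (snd (q (e k)) *v x) $ j \<le> fst (q (e k)) $ j * F x $ j + C / real (e k)) sequentially"
      using e_pos
    proof eventually_elim
      case (elim k)
      have "(a (e k) *v x) $ j / real (e k) \<le> (m (e k) $ j * F x $ j + C) / real (e k)"
        by (intro divide_right_mono t(5)) simp
      moreover have "(snd (q (e k)) *v x) $ j = (a (e k) *v x) $ j / real (e k)"
        by (simp add: q_def scaleR_matrix_vector_assoc[symmetric] divide_inverse mult.commute)
      ultimately show ?case
        by (simp add: q_def add_divide_distrib) (simp add: divide_inverse mult.commute mult.left_commute)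
    qed
    show ?thesis
      using tendsto_le[OF sequentially_bot 2 1 3] by simp
  qed
  have AM: "(1 v* A) $ l = M $ l" for l
  proof -
    have 1: "(\<lambda>k. (1 v* snd (q (e k))) $ l - fst (q (e k)) $ l) \<longlonglongrightarrow> (1 v* A) $ l - M $ l"
      unfolding vector_matrix_mult_def by (simp, intro tendsto_intros limA limM)
    have 2: "(\<lambda>k. (1 v* snd (q (e k))) $ l - fst (q (e k)) $ l) \<longlonglongrightarrow> 0"
    proof (rule Lim_null_comparison[OF _ C_lim])
      show "eventually (\<lambda>k. norm ((1 v* snd (q (e k))) $ l - fst (q (e k)) $ l) \<le> C / real (e k)) sequentially"
        using e_pos
      proof eventually_elim
        case (elim k)
        have "(1 v* snd (q (e k))) $ l - fst (q (e k)) $ l =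
            ((1 v* a (e k)) $ l - m (e k) $ l) / real (e k)"
          by (simp add: q_def vector_matrix_mult_def divide_inverse right_diff_distrib sum_distrib_left ac_simps)
        then show ?case
          using t(6)[of "e k" l] by (simp add: divide_right_mono)
      qed
    qed
    show ?thesis
      using LIMSEQ_unique[OF 1 2] by simp
  qed
  have "M = 0"
    by (rule no_occupation_outside_crit_nodes[OF M0 Mcrit AF]) (simp_all add: cart_eq_iff AM)
  moreover have "\<delta> \<le> W * (M \<bullet> 1)"
  proof -
    have "(\<lambda>k. W * (fst (q (e k)) \<bullet> 1)) \<longlonglongrightarrow> W * (M \<bullet> 1)"
      unfolding M_def e_def by (intro tendsto_intros tendsto_fst L)
    moreover have "eventually (\<lambda>k. \<delta> \<le> W * (fst (q (e k)) \<bullet> 1)) sequentially"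
    proof -
      have "(\<lambda>k. ((F ^^ d k) y - (F ^^ d k) z) $ i) \<longlonglongrightarrow> (y - z) $ i"
        using rec by (intro tendsto_intros) (auto simp: recurrent_along_def)
      from LIMSEQ_subseq_LIMSEQ[OF this r]
      have "(\<lambda>k. ((F ^^ e k) y - (F ^^ e k) z) $ i) \<longlonglongrightarrow> (y - z) $ i"
        by (simp add: o_def e_def)
      then have "eventually (\<lambda>k. \<delta> < ((F ^^ e k) y - (F ^^ e k) z) $ i) sequentially"
        by (rule order_tendstoD) (use i in \<open>simp add: \<delta>_def\<close>)
      with e_pos show ?thesis
      proof eventually_elim
        case (elim k)
        have "real (e k) * \<delta> \<le> real (e k) * ((F ^^ e k) y - (F ^^ e k) z) $ i"
          using elim by (intro mult_left_mono) auto
        also have "\<dots> \<le> W * (m (e k) \<bullet> 1)"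
          by (rule t(7))
        finally show ?case
          using elim by (simp add: q_def field_simps)
      qed
    qed
    ultimately show ?thesis
      by (rule tendsto_lowerbound) simp
  qed
  ultimately show False
    using \<delta> by simp
qed

text \<open>The critical coordinates already have this period, and both points return along the same
  times, so the comparison applies in both directions.\<close>

lemma recurrent_periodic:
  assumes rec: "recurrent_along d y"
  shows "(F ^^ cyclicity crit_digraph) y = y"
proof (rule antisym)
  let ?z = "(F ^^ cyclicity crit_digraph) y"
  have recz: "recurrent_along d ?z"
    by (rule recurrent_iterate[OF rec])
  have agree: "(F ^^ k) ?z $ j = (F ^^ k) y $ j" if "j \<in> crit_nodes" for k j
  proof -
    have "(F ^^ k) ?z = (F ^^ cyclicity crit_digraph) ((F ^^ k) y)"
      by (metis add.commute comp_apply funpow_add)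
    then show ?thesis
      using crit_node_periodic[OF that recurrent_iterate[OF rec]] by simp
  qed
  show "?z \<le> y"
    by (rule recurrent_le[OF recz rec agree])
  show "y \<le> ?z"
    by (rule recurrent_le[OF rec recz agree[symmetric]])
qed

end

section \<open>Convergence to periodic orbits\<close>

lemma lipschitz_iterates_lyapunov_stable:
  fixes f :: "real ^ 'n \<Rightarrow> real ^ 'n"
  assumes L: "0 < L" "\<And>k x y. dist ((f ^^ k) x) ((f ^^ k) y) \<le> L * dist x y"
    and per: "(f ^^ p) \<xi> = \<xi>"
  shows "lyapunov_stable_orbit f \<xi> p"
  unfolding lyapunov_stable_orbit_def
proof (intro allI impI)
  fix S assume S: "\<forall>i<p. (f ^^ i) \<xi> \<in> interior (S i)"
  have "\<exists>e>0. ball ((f ^^ i) \<xi>) e \<subseteq> S i" if "i < p" for i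
    using S that by (simp add: mem_interior)
  then obtain e where e: "\<And>i. i < p \<Longrightarrow> e i > 0" "\<And>i. i < p \<Longrightarrow> ball ((f ^^ i) \<xi>) (e i) \<subseteq> S i"
    by metis
  have fixed: "(f ^^ (k * p)) ((f ^^ i) \<xi>) = (f ^^ i) \<xi>" for k i
  proof -
    have "(f ^^ (k * p)) \<xi> = \<xi>"
      by (induction k) (simp_all add: funpow_add per)
    then show ?thesis
      by (metis add.commute comp_apply funpow_add)
  qed
  define V where "V i = ball ((f ^^ i) \<xi>) (e i / L)" for i
  have "(f ^^ (k * p)) y \<in> S i" if i: "i < p" and y: "y \<in> V i" for i y k
  proof -
    have "dist ((f ^^ i) \<xi>) ((f ^^ (k * p)) y) \<le> L * dist ((f ^^ i) \<xi>) y"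
      using L(2)[of "k * p" "(f ^^ i) \<xi>" y] by (simp add: fixed)
    also have "\<dots> < e i"
      using y L(1) by (simp add: V_def field_simps)
    finally show ?thesis
      using e(2)[OF i] by auto
  qed
  moreover have "(f ^^ i) \<xi> \<in> interior (V i)" if "i < p" for i
    using e(1)[OF that] L(1) by (simp add: V_def)
  ultimately show "\<exists>V. (\<forall>i<p. (f ^^ i) \<xi> \<in> interior (V i)) \<and>
      (\<forall>i<p. \<forall>y\<in>V i. \<forall>k. (f ^^ (k * p)) y \<in> S i)"
    by blast
qed

text \<open>Convergence along multiples of c improves to multiples of the minimal period: the limit
  is fixed by \<open>f ^^ p\<close>, and once the orbit is close to it, the uniform Lipschitz bound
  keeps it close at all later multiples of p.\<close>

lemma lipschitz_iterates_periodic_limit: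
  fixes f :: "real ^ 'n \<Rightarrow> real ^ 'n"
  assumes L: "0 < L" "\<And>k x y. dist ((f ^^ k) x) ((f ^^ k) y) \<le> L * dist x y"
    and c: "0 < c" and lim: "(\<lambda>k. (f ^^ (k * c)) x) \<longlonglongrightarrow> \<xi>"
  shows "\<exists>p. periodic_point f \<xi> p \<and> (\<lambda>k. (f ^^ (k * p)) x) \<longlonglongrightarrow> \<xi> \<and>
    lyapunov_stable_orbit f \<xi> p \<and> p dvd c"
proof -
  have cont: "continuous_on UNIV (f ^^ k)" for k
    by (rule lipschitz_on_continuous_on[of L], rule lipschitz_onI) (use L in \<open>simp_all add: less_imp_le\<close>)
  have "(\<lambda>k. (f ^^ c) ((f ^^ (k * c)) x)) \<longlonglongrightarrow> (f ^^ c) \<xi>"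
    by (rule continuous_on_tendsto_compose[OF cont lim]) auto
  moreover have "(\<lambda>k. (f ^^ c) ((f ^^ (k * c)) x)) \<longlonglongrightarrow> \<xi>"
    using LIMSEQ_Suc[OF lim] by (simp add: funpow_add)
  ultimately have c_per: "(f ^^ c) \<xi> = \<xi>"
    by (rule LIMSEQ_unique)
  define p where "p = (LEAST q. 0 < q \<and> (f ^^ q) \<xi> = \<xi>)"
  have p: "0 < p \<and> (f ^^ p) \<xi> = \<xi>"
    unfolding p_def using c c_per by (intro LeastI[of "\<lambda>q. 0 < q \<and> (f ^^ q) \<xi> = \<xi>" c]) simp
  have minimal: "(f ^^ q) \<xi> \<noteq> \<xi>" if "0 < q" "q < p" for q
    using not_less_Least[of q "\<lambda>q. 0 < q \<and> (f ^^ q) \<xi> = \<xi>"] that by (simp add: p_def)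
  have multiple: "(f ^^ (k * p)) \<xi> = \<xi>" for k
    by (induction k) (simp_all add: funpow_add p)
  have "(f ^^ (c mod p)) \<xi> = \<xi>"
  proof -
    have "(f ^^ (c mod p)) \<xi> = (f ^^ (c mod p)) ((f ^^ (c div p * p)) \<xi>)"
      by (simp only: multiple)
    also have "\<dots> = (f ^^ (c mod p + c div p * p)) \<xi>"
      by (simp only: funpow_add o_apply)
    finally show ?thesis
      by (simp add: c_per)
  qed
  then have "p dvd c"
    using minimal[of "c mod p"] p by (auto simp: dvd_eq_mod_eq_0)
  moreover have "(\<lambda>k. (f ^^ (k * p)) x) \<longlonglongrightarrow> \<xi>"
  proof (rule metric_LIMSEQ_I)
    fix e :: real assume "0 < e"
    then have "0 < e / L"
      using L(1) by simp
    from metric_LIMSEQ_D[OF lim this] obtain K where K: "dist ((f ^^ (K * c)) x) \<xi> < e / L"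
      by blast
    obtain b where b: "c = p * b"
      using \<open>p dvd c\<close> by (rule dvdE)
    have "dist ((f ^^ (k * p)) x) \<xi> < e" if "k \<ge> K * b" for k
    proof -
      have "k * p = (k - K * b) * p + K * c"
        using that by (simp add: b diff_mult_distrib mult.assoc mult.commute[of b p])
      then have "(f ^^ (k * p)) x = (f ^^ ((k - K * b) * p)) ((f ^^ (K * c)) x)"
        by (metis comp_apply funpow_add)
      then have "dist ((f ^^ (k * p)) x) \<xi> \<le> L * dist ((f ^^ (K * c)) x) \<xi>"
        using L(2)[of "(k - K * b) * p" "(f ^^ (K * c)) x" \<xi>] by (simp add: multiple)
      also have "\<dots> < e"
        using K L(1) by (simp add: field_simps)
      finally show ?thesis .
    qed
    then show "\<exists>no. \<forall>k\<ge>no. dist ((f ^^ (k * p)) x) \<xi> < e"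
      by blast
  qed
  moreover have "periodic_point f \<xi> p"
    using p minimal by (auto simp: periodic_point_def)
  moreover have "lyapunov_stable_orbit f \<xi> p"
    using L p by (intro lipschitz_iterates_lyapunov_stable[of L]) auto
  ultimately show ?thesis
    by blast
qed

context dominated_convex_map
begin

text \<open>The time between the visits \<open>r k\<close> and \<open>r (2 * k)\<close> brings the
  orbit from near y back near y; by the uniform Lipschitz bound it does the same with y itself.
  Doubling the index makes this time at least k.\<close>

lemma limit_point_recurrent:
  assumes r: "strict_mono r" and lim: "(\<lambda>k. (F ^^ r k) x) \<longlonglongrightarrow> y"
  shows "recurrent_along (\<lambda>k. r (2 * k) - r k) y"
  unfolding recurrent_along_def
proof
  have grow: "r k + m \<le> r (k + m)" for k m
  proof (induction m)
    case (Suc m)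
    have "r (k + m) < r (k + Suc m)"
      using r by (simp add: strict_mono_def)
    with Suc show ?case
      by simp
  qed simp
  have d_ge: "k \<le> r (2 * k) - r k" for k
    using grow[of k k] by (simp add: mult_2)
  show "filterlim (\<lambda>k. r (2 * k) - r k) at_top sequentially"
    by (rule filterlim_at_top_mono[OF filterlim_ident]) (simp add: d_ge)
  have lim2: "(\<lambda>k. (F ^^ r (2 * k)) x) \<longlonglongrightarrow> y"
    using LIMSEQ_subseq_LIMSEQ[OF lim, of "\<lambda>k. 2 * k"] by (simp add: strict_mono_def o_def)
  have "(\<lambda>k. lip * dist y ((F ^^ r k) x) + dist ((F ^^ r (2 * k)) x) y) \<longlonglongrightarrow> lip * dist y y + dist y y"
    by (intro tendsto_intros lim lim2)
  then have 1: "(\<lambda>k. lip * dist y ((F ^^ r k) x) + dist ((F ^^ r (2 * k)) x) y) \<longlonglongrightarrow> 0"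
    by simp
  have 2: "dist ((F ^^ (r (2 * k) - r k)) y) y \<le> lip * dist y ((F ^^ r k) x) + dist ((F ^^ r (2 * k)) x) y" for k
  proof -
    have "r (2 * k) = (r (2 * k) - r k) + r k"
      using grow[of k k] by (simp add: mult_2)
    then have "(F ^^ r (2 * k)) x = (F ^^ (r (2 * k) - r k)) ((F ^^ r k) x)"
      by (metis comp_apply funpow_add)
    then show ?thesis
      using dist_triangle[of "(F ^^ (r (2 * k) - r k)) y" y "(F ^^ r (2 * k)) x"]
        F_iterate_lipschitz[of "r (2 * k) - r k" y "(F ^^ r k) x"] by simp
  qed
  have "(\<lambda>k. dist ((F ^^ (r (2 * k) - r k)) y) y) \<longlonglongrightarrow> 0"
    by (rule Lim_null_comparison[OF _ 1]) (simp add: 2)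
  then show "(\<lambda>k. (F ^^ (r (2 * k) - r k)) y) \<longlonglongrightarrow> y"
    by (subst tendsto_dist_iff)
qed

lemma orbit_converges: "convergent (\<lambda>k. (F ^^ (k * cyclicity crit_digraph)) x)"
proof -
  let ?c = "cyclicity crit_digraph"
  have "bounded (range (\<lambda>k. (F ^^ k) x))"
    using F_iterate_norm_le by (auto simp: bounded_iff)
  from bounded_imp_convergent_subsequence[OF this] obtain y r
    where r: "strict_mono r" and "((\<lambda>k. (F ^^ k) x) \<circ> r) \<longlonglongrightarrow> y"
    by blast
  then have lim: "(\<lambda>k. (F ^^ r k) x) \<longlonglongrightarrow> y"
    by (simp add: o_def)
  have y: "(F ^^ ?c) y = y"
    by (rule recurrent_periodic[OF limit_point_recurrent[OF r lim]])
  have y': "(F ^^ (k * ?c)) y = y" for k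
    by (induction k) (simp_all add: funpow_add y)
  have "Cauchy (\<lambda>k. (F ^^ (k * ?c)) x)"
  proof (rule metric_CauchyI)
    fix e :: real assume "0 < e"
    then have "0 < e / (2 * lip)"
      using lip_pos by simp
    from metric_LIMSEQ_D[OF lim this] obtain N where "dist ((F ^^ r N) x) y < e / (2 * lip)"
      by blast
    then have N: "lip * dist ((F ^^ r N) x) y < e / 2"
      using lip_pos by (simp add: field_simps)
    \<comment> \<open>From time \<open>r N\<close> on, the orbit shadows that of y. At multiples of
      c the phase is constant; the exponent is a nonnegative representative of \<open>- r N\<close>
      modulo c.\<close>
    have close: "dist ((F ^^ (k * ?c)) x) ((F ^^ (r N * ?c - r N)) y) < e / 2" if k_ge: "k \<ge> r N" for k
    proof -
      obtain m where k: "k = r N + m"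
        using le_Suc_ex[OF k_ge] by blast
      have "r N * 1 \<le> r N * ?c"
        by (rule mult_le_mono2) (use cyclicity_pos[of crit_digraph] in simp)
      then have *: "k * ?c - r N = (r N * ?c - r N) + m * ?c" "k * ?c = (k * ?c - r N) + r N"
        by (simp_all only: k add_mult_distrib)
      have "(F ^^ (k * ?c - r N)) y = (F ^^ (r N * ?c - r N)) y"
        by (simp only: *(1) funpow_add o_apply y')
      moreover have "(F ^^ (k * ?c)) x = (F ^^ (k * ?c - r N)) ((F ^^ r N) x)"
        by (subst *(2)) (simp only: funpow_add o_apply)
      ultimately show ?thesis
        using F_iterate_lipschitz[of "k * ?c - r N" "(F ^^ r N) x" y] N by simp
    qed
    show "\<exists>M. \<forall>m\<ge>M. \<forall>n\<ge>M. dist ((F ^^ (m * ?c)) x) ((F ^^ (n * ?c)) x) < e"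
      by (intro exI[of _ "r N"] allI impI) (rule dist_triangle_half_l[OF close close])
  qed
  then show ?thesis
    by (simp add: Cauchy_convergent_iff)
qed

end

section \<open>Recession maps\<close>

lemma convex_slope_mono:
  fixes g :: "'a::real_vector \<Rightarrow> real"
  assumes g: "convex_on UNIV g" and rs: "0 < r" "r \<le> s"
  shows "(g (y + r *\<^sub>R x) - g y) / r \<le> (g (y + s *\<^sub>R x) - g y) / s"
proof -
  have "(1 - r / s) *\<^sub>R y + (r / s) *\<^sub>R (y + s *\<^sub>R x) = y + r *\<^sub>R x"
    using rs by (simp add: algebra_simps)
  moreover have "g ((1 - r / s) *\<^sub>R y + (r / s) *\<^sub>R (y + s *\<^sub>R x)) \<le> (1 - r / s) * g y + (r / s) * g (y + s *\<^sub>R x)"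
    using rs by (intro convex_onD[OF g]) auto
  ultimately have "g (y + r *\<^sub>R x) \<le> (1 - r / s) * g y + (r / s) * g (y + s *\<^sub>R x)"
    by simp
  then have "g (y + r *\<^sub>R x) - g y \<le> (r / s) * (g (y + s *\<^sub>R x) - g y)"
    by (simp add: algebra_simps)
  then show ?thesis
    using rs by (simp add: field_simps)
qed

text \<open>Guarantees that the \<open>Lim\<close> in \<open>directional_derivative\<close> is a
  true limit: the slopes decrease with the step, and a subgradient bounds them from below.\<close>

lemma convex_directional_derivative_exists:
  fixes g :: "'a::euclidean_space \<Rightarrow> real"
  assumes g: "convex_on UNIV g"
  shows "\<exists>l. ((\<lambda>\<epsilon>. (g (v + \<epsilon> *\<^sub>R y) - g v) / \<epsilon>) \<longlongrightarrow> l) (at_right 0)"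
proof -
  let ?\<phi> = "\<lambda>\<epsilon>. (g (v + \<epsilon> *\<^sub>R y) - g v) / \<epsilon>"
  obtain q where q: "\<And>x. q \<bullet> (x - v) \<le> g x - g v"
    using convex_subgradient_exists[OF g, of v] by blast
  have "q \<bullet> y \<le> ?\<phi> \<epsilon>" if "0 < \<epsilon>" for \<epsilon>
    using q[of "v + \<epsilon> *\<^sub>R y"] that by (simp add: field_simps)
  then have bdd: "bdd_below (?\<phi> ` {0<..})"
    by (auto simp: bdd_below_def)
  define l where "l = Inf (?\<phi> ` {0<..})"
  have "(?\<phi> \<longlongrightarrow> l) (at_right 0)"
  proof (rule order_tendstoI)
    fix a assume a: "a < l"
    have "a < ?\<phi> \<epsilon>" if "0 < \<epsilon>" for \<epsilon>
      using a cInf_lower[OF _ bdd, of "?\<phi> \<epsilon>"] that by (auto simp: l_def)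
    then show "eventually (\<lambda>\<epsilon>. a < ?\<phi> \<epsilon>) (at_right 0)"
      by (simp add: eventually_at_filter)
  next
    fix a assume "l < a"
    then obtain s where s: "0 < s" "?\<phi> s < a"
      using cInf_lessD[of "?\<phi> ` {0<..}" a] by (auto simp: l_def)
    have "?\<phi> \<epsilon> < a" if "0 < \<epsilon>" "\<epsilon> < s" for \<epsilon>
      using convex_slope_mono[OF g, of \<epsilon> s v y] that s by simp
    then show "eventually (\<lambda>\<epsilon>. ?\<phi> \<epsilon> < a) (at_right 0)"
      using s(1) by (auto simp: eventually_at_right)
  qed
  then show ?thesis
    by blast
qed

lemma convex_map_translate:
  assumes "convex_map f"
  shows "convex_map (\<lambda>x. f (v + x) - w)"
  unfolding convex_map_def
proof
  fix i
  have f: "convex_on UNIV (\<lambda>x. f x $ i)"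
    using assms by (simp add: convex_map_def)
  show "convex_on UNIV (\<lambda>x. (f (v + x) - w) $ i)"
  proof (rule convex_onI)
    fix t x y :: _ assume t: "0 < t" "t < (1 :: real)"
    have "v + ((1 - t) *\<^sub>R x + t *\<^sub>R y) = (1 - t) *\<^sub>R (v + x) + t *\<^sub>R (v + y)"
      by (simp add: algebra_simps)
    then have "f (v + ((1 - t) *\<^sub>R x + t *\<^sub>R y)) $ i \<le> (1 - t) * f (v + x) $ i + t * f (v + y) $ i"
      using convex_onD[OF f, of t "v + x" "v + y"] t by simp
    then show "(f (v + ((1 - t) *\<^sub>R x + t *\<^sub>R y)) - w) $ i \<le>
        (1 - t) * (f (v + x) - w) $ i + t * (f (v + y) - w) $ i"
      by (simp add: algebra_simps)
  qed simp
qed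

text \<open>Slopes from 0 increase with r, so they tend to their supremum in the extended reals; the
  term \<open>g 0 / r\<close> by which they differ from the defining quotient vanishes.\<close>

lemma recession_map_tendsto:
  assumes f: "convex_map f" and fin: "\<bar>recession_map f x $ i\<bar> \<noteq> \<infinity>"
  shows "((\<lambda>r. f (r *\<^sub>R x) $ i / r) \<longlongrightarrow> real_of_ereal (recession_map f x $ i)) at_top"
proof -
  define g where "g x = f x $ i" for x
  have g: "convex_on UNIV g"
    using f by (simp add: convex_map_def g_def[abs_def])
  define \<phi> where "\<phi> r = ereal ((g (r *\<^sub>R x) - g 0) / r)" for r
  have \<phi>_mono: "\<phi> r \<le> \<phi> s" if "0 < r" "r \<le> s" for r s
    using convex_slope_mono[OF g that, of 0 x] by (simp add: \<phi>_def)
  define S where "S = (SUP r\<in>{0<..}. \<phi> r)"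
  have S: "(\<phi> \<longlongrightarrow> S) at_top"
  proof (rule order_tendstoI)
    fix a assume "a < S"
    then obtain s where s: "0 < s" "a < \<phi> s"
      by (auto simp: S_def less_SUP_iff)
    then show "eventually (\<lambda>r. a < \<phi> r) at_top"
      using \<phi>_mono by (intro eventually_at_top_linorderI[of s]) (auto intro: less_le_trans)
  next
    fix a assume a: "S < a"
    have "\<phi> r < a" if "0 < r" for r
      using a that by (auto simp: S_def intro: le_less_trans[OF SUP_upper])
    then show "eventually (\<lambda>r. \<phi> r < a) at_top"
      by (intro eventually_at_top_linorderI[of 1]) auto
  qed
  have "((\<lambda>r. ereal (g 0 / r)) \<longlongrightarrow> 0) at_top"
    unfolding zero_ereal_def lim_ereal by real_asymp
  from tendsto_add_ereal_general1[OF _ S this]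
  have "((\<lambda>r. \<phi> r + ereal (g 0 / r)) \<longlongrightarrow> S) at_top"
    by simp
  then have lim: "((\<lambda>r. ereal (f (r *\<^sub>R x) $ i / r)) \<longlongrightarrow> S) at_top"
    by (simp add: \<phi>_def g_def diff_divide_distrib)
  then have "recession_map f x $ i = S"
    by (simp add: recession_map_def tendsto_Lim)
  with fin obtain l where l: "recession_map f x $ i = ereal l" "S = ereal l"
    by (cases S) auto
  show ?thesis
    using lim unfolding l by (simp add: lim_ereal)
qed

definition real_recession :: "(real ^ 'n \<Rightarrow> real ^ 'n) \<Rightarrow> real ^ 'n \<Rightarrow> real ^ 'n" where
  "real_recession f x = (\<chi> i. real_of_ereal (recession_map f x $ i))"

context
  fixes f :: "real ^ 'n \<Rightarrow> real ^ 'n"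
  assumes f_convex: "convex_map f" and f_mono: "mono f"
    and recession: "recession_orbits_bounded_above f"
begin

lemma real_recession_tendsto: "((\<lambda>r. f (r *\<^sub>R x) $ i / r) \<longlongrightarrow> real_recession f x $ i) at_top"
  using recession_map_tendsto[OF f_convex] recession
  by (auto simp: recession_orbits_bounded_above_def real_recession_def)

lemma real_recession_mono: "mono (real_recession f)"
proof (rule monoI)
  fix x y :: "real ^ 'n" assume "x \<le> y"
  have "real_recession f x $ i \<le> real_recession f y $ i" for i
  proof (rule tendsto_le[OF _ real_recession_tendsto real_recession_tendsto])
    have "f (r *\<^sub>R x) $ i / r \<le> f (r *\<^sub>R y) $ i / r" if "0 < r" for r
    proof -
      have "r *\<^sub>R x \<le> r *\<^sub>R y"
        using that \<open>x \<le> y\<close> by (simp add: vec_le_iff mult_left_mono)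
      then have "f (r *\<^sub>R x) \<le> f (r *\<^sub>R y)"
        by (rule monoD[OF f_mono])
      then show ?thesis
        using that by (simp add: vec_le_iff divide_right_mono)
    qed
    then show "eventually (\<lambda>r. f (r *\<^sub>R x) $ i / r \<le> f (r *\<^sub>R y) $ i / r) at_top"
      by (intro eventually_at_top_linorderI[of 1]) auto
  qed simp
  then show "real_recession f x \<le> real_recession f y"
    by (simp add: vec_le_iff)
qed

lemma real_recession_scale:
  assumes a: "0 < a"
  shows "real_recession f (a *\<^sub>R x) = a *\<^sub>R real_recession f x"
proof -
  have "real_recession f (a *\<^sub>R x) $ i = a * real_recession f x $ i" for i
  proof (rule tendsto_unique[OF _ real_recession_tendsto])
    have "filterlim (\<lambda>r. r * a) at_top at_top"
      using a by real_asymp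
    from filterlim_compose[OF real_recession_tendsto this]
    have "((\<lambda>r. a * (f ((r * a) *\<^sub>R x) $ i / (r * a))) \<longlongrightarrow> a * real_recession f x $ i) at_top"
      by (intro tendsto_intros)
    then show "((\<lambda>r. f (r *\<^sub>R a *\<^sub>R x) $ i / r) \<longlongrightarrow> a * real_recession f x $ i) at_top"
      using a by simp
  qed simp
  then show ?thesis
    by (simp add: cart_eq_iff)
qed

text \<open>The slope of \<open>f\<close> from \<open>x\<close> in direction \<open>z\<close> increases with the step; at step \<open>r\<close>, convexity
  between \<open>2 r z\<close> and \<open>2 x\<close> compares it with the quotient defining the recession map.\<close>

lemma diff_le_real_recession: "f x - f y \<le> real_recession f (x - y)"
  unfolding vec_le_iff
proof
  fix i
  let ?z = "x - y"
  define g where "g x = f x $ i" for x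
  have g: "convex_on UNIV g"
    using f_convex by (simp add: convex_map_def g_def[abs_def])
  have bound: "g x - g y \<le> g ((r * 2) *\<^sub>R ?z) / (r * 2) + (g (2 *\<^sub>R y) / 2 - g y) / r" if r: "1 \<le> r" for r
  proof -
    have "g x - g y \<le> (g (y + r *\<^sub>R ?z) - g y) / r"
      using convex_slope_mono[OF g _ r, of y ?z] by simp
    \<comment> \<open>The midpoint of \<open>(r * 2) *\<^sub>R ?z\<close> and
      \<open>2 *\<^sub>R y\<close> is \<open>y + r *\<^sub>R ?z\<close>, which isolates a multiple
      of the direction at the cost of a term that is constant in r.\<close>
    moreover have "g ((1 / 2) *\<^sub>R ((r * 2) *\<^sub>R ?z) + (1 / 2) *\<^sub>R (2 *\<^sub>R y)) \<le>
        (1 / 2) * g ((r * 2) *\<^sub>R ?z) + (1 / 2) * g (2 *\<^sub>R y)"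
      using convex_onD[OF g, of "1 / 2" "(r * 2) *\<^sub>R ?z" "2 *\<^sub>R y"] by simp
    then have "g (y + r *\<^sub>R ?z) \<le> g ((r * 2) *\<^sub>R ?z) / 2 + g (2 *\<^sub>R y) / 2"
      by (simp add: add.commute)
    then have "(g (y + r *\<^sub>R ?z) - g y) / r \<le> (g ((r * 2) *\<^sub>R ?z) / 2 + g (2 *\<^sub>R y) / 2 - g y) / r"
      using r by (intro divide_right_mono) auto
    ultimately show ?thesis
      by (simp add: add_divide_distrib diff_divide_distrib mult.commute)
  qed
  have "filterlim (\<lambda>r::real. r * 2) at_top at_top"
    by real_asymp
  from filterlim_compose[OF real_recession_tendsto this, of ?z i]
  have "((\<lambda>r. g ((r * 2) *\<^sub>R ?z) / (r * 2)) \<longlongrightarrow> real_recession f ?z $ i) at_top"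
    by (simp add: g_def)
  moreover have "((\<lambda>r. (g (2 *\<^sub>R y) / 2 - g y) / r) \<longlongrightarrow> 0) at_top"
    by real_asymp
  ultimately have "((\<lambda>r. g ((r * 2) *\<^sub>R ?z) / (r * 2) + (g (2 *\<^sub>R y) / 2 - g y) / r) \<longlongrightarrow>
      real_recession f ?z $ i + 0) at_top"
    by (rule tendsto_add)
  moreover have "eventually (\<lambda>r. g x - g y \<le> g ((r * 2) *\<^sub>R ?z) / (r * 2) + (g (2 *\<^sub>R y) / 2 - g y) / r) at_top"
    by (rule eventually_at_top_linorderI[of 1]) (rule bound)
  ultimately have "g x - g y \<le> real_recession f ?z $ i + 0"
    by (rule tendsto_lowerbound) simp
  then show "(f x - f y) $ i \<le> real_recession f (x - y) $ i"
    by (simp add: g_def)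
qed

lemma directional_derivative_le: "directional_derivative f v y \<le> real_recession f y"
proof -
  have "\<exists>l. ((\<lambda>\<epsilon>. (f (v + \<epsilon> *\<^sub>R y) $ i - f v $ i) / \<epsilon>) \<longlongrightarrow> l) (at_right 0)" for i
    using f_convex by (intro convex_directional_derivative_exists) (simp add: convex_map_def)
  from choice[OF allI[OF this]] obtain l where
    "\<forall>i. ((\<lambda>\<epsilon>. (f (v + \<epsilon> *\<^sub>R y) $ i - f v $ i) / \<epsilon>) \<longlongrightarrow> l i) (at_right 0)" ..
  then have l: "((\<lambda>\<epsilon>. (f (v + \<epsilon> *\<^sub>R y) $ i - f v $ i) / \<epsilon>) \<longlongrightarrow> l i) (at_right 0)" for i
    ..
  have "((\<lambda>\<epsilon>. (f (v + \<epsilon> *\<^sub>R y) - f v) /\<^sub>R \<epsilon>) \<longlongrightarrow> (\<chi> i. l i)) (at_right 0)"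
    by (rule vec_tendstoI) (use l in \<open>simp add: divide_inverse mult.commute\<close>)
  then have "directional_derivative f v y = (\<chi> i. l i)"
    unfolding directional_derivative_def by (intro tendsto_Lim) simp_all
  moreover have "l i \<le> real_recession f y $ i" for i
  proof (rule tendsto_upperbound[OF l])
    have "(f (v + \<epsilon> *\<^sub>R y) $ i - f v $ i) / \<epsilon> \<le> real_recession f y $ i" if "0 < \<epsilon>" for \<epsilon>
      using diff_le_real_recession[of "v + \<epsilon> *\<^sub>R y" v] that
      by (simp add: real_recession_scale vec_le_iff divide_le_eq mult.commute)
    then show "eventually (\<lambda>\<epsilon>. (f (v + \<epsilon> *\<^sub>R y) $ i - f v $ i) / \<epsilon> \<le> real_recession f y $ i) (at_right 0)"
      by (simp add: eventually_at_filter)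
  qed simp
  ultimately show ?thesis
    by (simp add: vec_le_iff)
qed

lemma real_recession_orbits_bounded: "orbits_bounded_above (real_recession f)"
  using recession unfolding recession_orbits_bounded_above_def real_recession_def[abs_def] by blast

text \<open>Orbits of the directional derivative stay below those of the recession map, by
  monotonicity of the latter. Hence the choice in \<open>critical_digraph_map\<close> yields an
  actual fixed point.\<close>

lemma fixed_point_t_stable:
  assumes "f v = v"
  shows "t_stable_fixed_point f v"
  unfolding t_stable_fixed_point_def orbits_bounded_above_def
proof (intro conjI allI)
  fix x
  have "(directional_derivative f v ^^ k) x \<le> (real_recession f ^^ k) x" for k
  proof (induction k)
    case (Suc k)
    have "directional_derivative f v ((directional_derivative f v ^^ k) x) \<le>
        real_recession f ((directional_derivative f v ^^ k) x)"
      by (rule directional_derivative_le)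
    also have "\<dots> \<le> real_recession f ((real_recession f ^^ k) x)"
      by (rule monoD[OF real_recession_mono Suc])
    finally show ?case
      by simp
  qed simp
  then show "\<exists>u. \<forall>k. (directional_derivative f v ^^ k) x \<le> u"
    using real_recession_orbits_bounded unfolding orbits_bounded_above_def by (meson order_trans)
qed (rule assms)

end

theorem theorem9p3:
  fixes f :: "real ^ 'n \<Rightarrow> real ^ 'n"
  assumes "convex_map f" and "mono f"
    and "\<exists>v. f v = v"
    and "recession_orbits_bounded_above f"
  shows "\<forall>x. \<exists>\<xi> p. periodic_point f \<xi> p \<and>
    (\<lambda>k. (f ^^ (k * p)) x) \<longlonglongrightarrow> \<xi> \<and>
    lyapunov_stable_orbit f \<xi> p \<and>
    p dvd cyclicity_map f"
proof
  fix x
  \<comment> \<open>The very point that \<open>critical_digraph_map\<close> selects, so that after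
    the translation the critical graph of f is \<open>crit_digraph\<close>.\<close>
  define v where "v = (SOME v. t_stable_fixed_point f v)"
  have "t_stable_fixed_point f v"
    unfolding v_def using assms fixed_point_t_stable by (intro someI_ex[of "t_stable_fixed_point f"]) blast
  then have v: "f v = v"
    by (simp add: t_stable_fixed_point_def)
  define F where "F x = f (v + x) - v" for x
  obtain U where U: "\<And>k. (real_recession f ^^ k) 1 \<le> U"
    using real_recession_orbits_bounded[OF assms(1,2,4)] unfolding orbits_bounded_above_def by blast
  interpret dominated_convex_map F "real_recession f" U
  proof
    show "F 0 = 0"
      by (simp add: F_def v)
    show "mono F"
    proof (rule monoI)
      fix x y :: "real ^ 'n" assume "x \<le> y"
      then have "f (v + x) \<le> f (v + y)"
        by (intro monoD[OF assms(2)]) (simp add: vec_le_iff)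
      then show "F x \<le> F y"
        by (simp add: F_def vec_le_iff)
    qed
    show "convex_map F"
      unfolding F_def by (rule convex_map_translate[OF assms(1)])
    show "F x - F y \<le> real_recession f (x - y)" for x y
      using diff_le_real_recession[OF assms(1,2,4), of "v + x" "v + y"] by (simp add: F_def)
    show "mono (real_recession f)"
      by (rule real_recession_mono[OF assms(1,2,4)])
    show "real_recession f (a *\<^sub>R x) = a *\<^sub>R real_recession f x" if "0 < a" for a x
      by (rule real_recession_scale[OF assms(1,2,4) that])
    show "(real_recession f ^^ k) 1 \<le> U" for k
      by (rule U)
  qed
  have iterate: "(f ^^ k) x = v + (F ^^ k) (x - v)" for k x
    by (induction k) (simp_all add: F_def)
  have "subdifferential f v = subdifferential F 0"
  proof -
    have "(\<forall>x. M *v (x - v) \<le> f x - v) \<longleftrightarrow> (\<forall>x. M *v x \<le> f (v + x) - v)" for M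
      by (metis add_diff_cancel_left' diff_add_cancel add.commute)
    then show ?thesis
      by (simp add: subdifferential_def F_def v)
  qed
  then have cyc: "cyclicity_map f = cyclicity crit_digraph"
    by (simp add: cyclicity_map_def critical_digraph_map_def crit_digraph_def flip: v_def)
  obtain \<xi> where "(\<lambda>k. (F ^^ (k * cyclicity_map f)) (x - v)) \<longlonglongrightarrow> \<xi>"
    using orbit_converges unfolding cyc convergent_def by blast
  then have "(\<lambda>k. (f ^^ (k * cyclicity_map f)) x) \<longlonglongrightarrow> v + \<xi>"
    unfolding iterate by (intro tendsto_intros)
  moreover have "dist ((f ^^ k) x) ((f ^^ k) y) \<le> lip * dist x y" for k x y
    using F_iterate_lipschitz[of k "x - v" "y - v"] unfolding iterate by (simp add: dist_norm)
  ultimately show "\<exists>\<xi> p. periodic_point f \<xi> p \<and> (\<lambda>k. (f ^^ (k * p)) x) \<longlonglongrightarrow> \<xi> \<and>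
      lyapunov_stable_orbit f \<xi> p \<and> p dvd cyclicity_map f"
    using lipschitz_iterates_periodic_limit[OF lip_pos, of f "cyclicity_map f" x "v + \<xi>"] cyclicity_pos[of crit_digraph]
    unfolding cyc by blast
qed

end
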